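(* Let $n$ be a positive odd integer, and for $k\geqslant 0$ let $$c_q(k)=[4k+1]\frac{(aq,q/a;q^2)_k(q;q^2)_k^2}{(aq^2,q^2/a;q^2)_k(q^2;q^2)_k^2}.$$ Then $$\sum_{k=0}^{n-1}\sum_{j=0}^{k}c_q(j)c_q(k-j)\equiv q^{1-n}[n]^2\pmod{[n]\Phi_n(q)(1-aq^n)(a-q^n)}.$$
   Context: Here $q$ and $a$ are indeterminates. The $q$-shifted factorial is $(x;q)_0=1$ and $(x;q)_m=(1-x)(1-xq)\cdots(1-xq^{m-1})$ for $m\geqslant1$, with $(x_1,\ldots,x_r;q)_m=(x_1;q)_m\cdots(x_r;q)_m$; the $q$-integer is $[m]=1+q+\cdots+q^{m-1}$; $\Phi_n(q)$ is the $n$-th cyclotomic polynomial. For rational functions $A,B$ in $q,a$ and a polynomial $P$ in $q,a$, $A\equiv B\pmod{P}$ means that $A-B=P\cdot U/V$ for polynomials $U,V$ with $V$ coprime to $P$. *)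

theory Defs
  imports
    Complex_Main
    "HOL-Computational_Algebra.Computational_Algebra"
    "HOL-Number_Theory.Totient"
begin

text \<open>
  Polynomials in \<open>q\<close> and \<open>a\<close> have type \<open>rat poly poly\<close>: the inner variable is \<open>q\<close> and the outer
  variable is \<open>a\<close>.  Rational functions in \<open>q\<close> and \<open>a\<close> have type \<open>rat poly poly fract\<close>.
\<close>

definition pol_q :: "rat poly poly" where
  "pol_q = [:[:0, 1:]:]"

definition pol_a :: "rat poly poly" where
  "pol_a = [:0, 1:]"

definition rat_q :: "rat poly poly fract" where
  "rat_q = to_fract pol_q"

definition rat_a :: "rat poly poly fract" where
  "rat_a = to_fract pol_a"

definition qint :: "'a::comm_ring_1 \<Rightarrow> nat \<Rightarrow> 'a" where
  "qint q m = (\<Sum>i<m. q ^ i)"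

definition qpoch :: "'a::comm_ring_1 \<Rightarrow> 'a \<Rightarrow> nat \<Rightarrow> 'a" where
  "qpoch x q m = (\<Prod>i<m. 1 - x * q ^ i)"

definition cq :: "'a::field \<Rightarrow> 'a \<Rightarrow> nat \<Rightarrow> 'a" where
  "cq a q k = qint q (4 * k + 1) *
     (qpoch (a * q) (q^2) k * qpoch (q / a) (q^2) k * (qpoch q (q^2) k)^2) /
     (qpoch (a * q^2) (q^2) k * qpoch (q^2 / a) (q^2) k * (qpoch (q^2) (q^2) k)^2)"

definition cyclotomic_complex :: "nat \<Rightarrow> complex poly" where
  "cyclotomic_complex n = (\<Prod>k\<in>totatives n. [:- cis (2 * pi * real k / real n), 1:])"

text \<open>
  The product over the primitive \<open>n\<close>-th roots of unity has rational coefficients for \<open>n > 0\<close>;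
  lemma \<open>map_poly_cyclotomic\<close> below shows that the description is proper.
\<close>

definition cyclotomic :: "nat \<Rightarrow> rat poly" where
  "cyclotomic n = (THE p. map_poly of_rat p = cyclotomic_complex n)"

text \<open>
  Here \<^term>\<open>coprime V P\<close> means that every common divisor of \<open>V\<close> and \<open>P\<close> in the ring of
  polynomials in \<open>q\<close> and \<open>a\<close> is a unit, that is, a nonzero constant.
\<close>

definition ratfun_cong ::
  "rat poly poly fract \<Rightarrow> rat poly poly fract \<Rightarrow> rat poly poly \<Rightarrow> bool" where
  "ratfun_cong A B P \<longleftrightarrow>
     (\<exists>U V. V \<noteq> 0 \<and> coprime V P \<and> A - B = to_fract P * (to_fract U / to_fract V))"


lemma map_poly_of_rat_add:
  "map_poly of_rat (p + r) = (map_poly of_rat p + map_poly of_rat r :: 'a::field_char_0 poly)"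
  by (intro poly_eqI) (simp add: coeff_map_poly of_rat_add)

lemma map_poly_of_rat_mult:
  "map_poly of_rat (p * r) = (map_poly of_rat p * map_poly of_rat r :: 'a::field_char_0 poly)"
  by (intro poly_eqI) (simp add: coeff_map_poly coeff_mult of_rat_sum of_rat_mult)

lemma map_poly_of_rat_prod:
  "map_poly of_rat (\<Prod>x\<in>A. f x) = (\<Prod>x\<in>A. map_poly of_rat (f x) :: 'a::field_char_0 poly)"
  by (induction A rule: infinite_finite_induct) (simp_all add: map_poly_of_rat_mult)

lemma map_poly_of_rat_inject:
  "(map_poly of_rat p :: 'a::field_char_0 poly) = map_poly of_rat r \<longleftrightarrow> p = r"
proof
  assume "(map_poly of_rat p :: 'a poly) = map_poly of_rat r"
  then have "coeff (map_poly of_rat p :: 'a poly) i = coeff (map_poly of_rat r) i" for i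
    by simp
  then show "p = r"
    by (intro poly_eqI) (simp add: coeff_map_poly)
qed simp

lemma prod_cyclotomic_complex:
  assumes "n > 0"
  shows "(\<Prod>d | d dvd n. cyclotomic_complex d) = monom 1 n - 1"
proof -
  let ?z = "\<lambda>k. cis (2 * pi * real k / real n)"
  let ?A = "\<lambda>d. {k\<in>{0<..n}. gcd k n = d}"
  have fin: "finite {d. d dvd n}"
    using assms by simp
  have "(\<Prod>k\<in>{0<..n}. [:- ?z k, 1:]) = (\<Prod>d | d dvd n. \<Prod>k\<in>?A d. [:- ?z k, 1:])"
    by (rule prod.group[OF _ fin, symmetric]) auto
  also have "\<dots> = (\<Prod>d | d dvd n. cyclotomic_complex (n div d))"
  proof (intro prod.cong refl)
    fix d assume "d \<in> {d. d dvd n}"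
    then have d: "d dvd n" "d > 0"
      using assms by (auto intro: Nat.gr0I)
    have eq: "?z (k * d) = cis (2 * pi * real k / real (n div d))" for k
      using d by (simp add: real_of_nat_div mult.assoc)
    show "(\<Prod>k\<in>?A d. [:- ?z k, 1:]) = cyclotomic_complex (n div d)"
      unfolding cyclotomic_complex_def
      by (subst prod.reindex_bij_betw[OF bij_betw_totatives_gcd_eq[OF d(1) assms], symmetric])
         (simp only: eq)
  qed
  also have "\<dots> = (\<Prod>d | d dvd n. cyclotomic_complex d)"
    by (rule prod.reindex_bij_witness[of _ "\<lambda>d. n div d" "\<lambda>d. n div d"])
       (use assms in \<open>auto elim!: dvdE\<close>)
  finally have 1: "(\<Prod>d | d dvd n. cyclotomic_complex d) = (\<Prod>k\<in>{0<..n}. [:- ?z k, 1:])" ..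
  have 2: "(\<Prod>k\<in>{0<..n}. [:- ?z k, 1:]) = (\<Prod>k<n. [:- ?z k, 1:])"
  proof (rule prod.reindex_bij_witness[of _ "\<lambda>k. if k = 0 then n else k" "\<lambda>k. if k = n then 0 else k"])
    fix k assume "k \<in> {0<..n}"
    then show "[:- ?z (if k = n then 0 else k), 1:] = [:- ?z k, 1:]"
      using assms by auto
  qed (use assms in \<open>auto split: if_splits\<close>)
  have 3: "(\<Prod>k<n. [:- ?z k, 1:]) = (\<Prod>z\<in>{z. z ^ n = 1}. [:- z, 1:])"
    by (rule prod.reindex_bij_betw[OF bij_betw_roots_unity[OF assms]])
  have 4: "(\<Prod>z\<in>{z. z ^ n = 1}. [:- z, 1:]) = (monom 1 n - 1 :: complex poly)" (is "?L = ?R")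
  proof (rule poly_eqI_degree_lead_coeff)
    have card: "card {z::complex. z ^ n = 1} = n"
      using assms by (simp add: card_roots_unity_eq)
    then show "card {z::complex. z ^ n = 1} \<ge> n" by simp
    have deg: "degree ?L = n"
      by (subst degree_prod_eq_sum_degree) (simp_all add: card)
    then show "degree ?L \<le> n" by simp
    show "degree ?R \<le> n"
      by (intro degree_diff_le degree_monom_le) simp
    have "lead_coeff ?L = 1"
      by (simp add: lead_coeff_prod)
    then have "coeff ?L n = 1"
      using deg by simp
    then show "coeff ?L n = coeff ?R n"
      using assms by simp
  next
    fix z :: complex assume z: "z \<in> {z. z ^ n = 1}"
    have "finite {z::complex. z ^ n = 1}"
      using assms by (simp add: finite_roots_unity)
    with z have "poly ?L z = 0"
      by (auto simp: poly_prod)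
    then show "poly ?L z = poly ?R z"
      using z by (simp add: poly_monom)
  qed
  show ?thesis
    unfolding 1 2 3 4 ..
qed

lemma ex_rat_cyclotomic:
  assumes "n > 0"
  shows "\<exists>p. map_poly of_rat p = cyclotomic_complex n"
  using assms
proof (induction n rule: less_induct)
  case (less n)
  let ?D = "{d. d dvd n \<and> d \<noteq> n}"
  have D: "{d. d dvd n} = insert n ?D" "finite ?D"
    using less.prems by auto
  have "\<forall>d\<in>?D. \<exists>p. map_poly of_rat p = cyclotomic_complex d"
  proof
    fix d assume "d \<in> ?D"
    then have "d < n" "d > 0"
      using less.prems by (auto dest: dvd_imp_le intro: Nat.gr0I le_neq_implies_less)
    then show "\<exists>p. map_poly of_rat p = cyclotomic_complex d"
      by (rule less.IH)
  qed
  then obtain f where f: "\<And>d. d \<in> ?D \<Longrightarrow> map_poly of_rat (f d) = cyclotomic_complex d"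
    by metis
  define R where "R = (\<Prod>d\<in>?D. f d)"
  define X where "X = (monom 1 n - 1 :: rat poly)"
  let ?m = "map_poly of_rat :: rat poly \<Rightarrow> complex poly"
  have R: "?m R = (\<Prod>d\<in>?D. cyclotomic_complex d)"
    unfolding R_def map_poly_of_rat_prod by (intro prod.cong refl f)
  have "\<forall>d. cyclotomic_complex d \<noteq> 0"
    by (auto simp: cyclotomic_complex_def)
  then have R0: "?m R \<noteq> 0"
    unfolding R using D(2) by simp
  then have "R \<noteq> 0" by auto
  have X: "?m X = cyclotomic_complex n * ?m R"
  proof -
    have "?m X = monom 1 n - 1"
      unfolding X_def by (intro poly_eqI) (simp add: coeff_map_poly of_rat_diff)
    also have "\<dots> = (\<Prod>d | d dvd n. cyclotomic_complex d)"
      using less.prems by (simp add: prod_cyclotomic_complex)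
    also have "\<dots> = cyclotomic_complex n * ?m R"
      unfolding R D(1) using D(2) by simp
    finally show ?thesis .
  qed
  have "?m X = ?m (X div R) * ?m R + ?m (X mod R)"
    by (simp flip: map_poly_of_rat_mult map_poly_of_rat_add)
  with X have eq: "(cyclotomic_complex n - ?m (X div R)) * ?m R = ?m (X mod R)"
    by (simp add: algebra_simps)
  have "cyclotomic_complex n - ?m (X div R) = 0"
  proof (rule ccontr)
    assume nz: "cyclotomic_complex n - ?m (X div R) \<noteq> 0"
    then have "?m (X mod R) \<noteq> 0"
      using eq R0 by (metis mult_eq_0_iff)
    then have "X mod R \<noteq> 0" by auto
    have "degree R = degree (?m R)"
      by (rule sym, rule degree_map_poly) simp
    also have "\<dots> \<le> degree (?m (X mod R))"
      unfolding eq[symmetric] using nz R0 by (simp add: degree_mult_eq)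
    also have "\<dots> \<le> degree (X mod R)"
      by (subst degree_map_poly) simp_all
    also have "\<dots> < degree R"
      using \<open>R \<noteq> 0\<close> \<open>X mod R \<noteq> 0\<close> by (simp add: degree_mod_less')
    finally show False by simp
  qed
  then show ?case by auto
qed

lemma map_poly_cyclotomic:
  assumes "n > 0"
  shows "map_poly of_rat (cyclotomic n) = cyclotomic_complex n"
proof -
  from ex_rat_cyclotomic[OF assms]
  have "\<exists>!p. map_poly of_rat p = cyclotomic_complex n"
    by (metis map_poly_of_rat_inject)
  then show ?thesis
    unfolding cyclotomic_def by (rule theI')
qed

end

theory Submission
  imports Defs "HOL-Computational_Algebra.Field_as_Ring" "HOL-Library.Real_Mod"
begin

text \<open>
  The modulus splits into pairwise coprime factors, and each is handled in the local ring of
  rational functions whose denominators are coprime to it.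

  Modulo \<open>1 - a q^n\<close> and \<open>a - q^n\<close> one may replace \<open>1/a\<close> resp. \<open>a\<close> by \<open>q^n\<close>.  Then \<open>c_q(k)\<close> vanishes for
  \<open>2k > n\<close>, so the double sum is the square of \<open>\<Sum>k. c_q(k)\<close>, which is evaluated by creative telescoping.

  For \<open>d = 2m + 1\<close> dividing \<open>n\<close>, working modulo \<open>\<Phi>_d(q)\<close>: \<open>c_q(m - k) \<equiv> - c_q(k)\<close> for \<open>k \<le> m\<close>, and
  \<open>c_q(k) \<equiv> 0\<close> even modulo \<open>\<Phi>_d(q)^2\<close> for \<open>m < k < d\<close>; so \<open>T = \<Sum>k\<le>m. c_q(k)\<close> is divisible by
  \<open>\<Phi>_d(q)\<close>.  Moreover \<open>c_q(l d + k) \<equiv> u_l c_q(k)\<close>, and two remainders \<open>\<le> m\<close> add without carry, so the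
  double sum has the factor \<open>T^2\<close>.  When \<open>d = n\<close> only \<open>l = 0\<close> occurs and the congruence holds modulo
  \<open>\<Phi>_n(q)^2\<close>.
\<close>

section \<open>The terminating sum\<close>

text \<open>The factors of \<open>cq\<close> at odd and at even powers of \<open>q\<close> are
  values of this one function, so periodicity and reflection modulo \<open>\<Phi>_d\<close> have to
  be shown for it alone.\<close>

definition wp_factor :: "'a::field \<Rightarrow> 'a \<Rightarrow> 'a" where
  "wp_factor a x = (1 - a * x) * (1 - x / a) * (1 - x)^2"

text \<open>\<open>cq\<close> without the factor \<open>qint\<close>, written as one product: it
  splits over blocks of indices and grows by one factor in an induction.\<close>

definition cq_ratio :: "'a::field \<Rightarrow> 'a \<Rightarrow> nat \<Rightarrow> 'a" where
  "cq_ratio a q k = (\<Prod>i<k. wp_factor a (q ^ (2 * i + 1)) / wp_factor a (q ^ (2 * i + 2)))"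

lemma cq_eq: "cq a q k = qint q (4 * k + 1) * cq_ratio a q k"
proof -
  have "q ^ 2 * q ^ (2 * i) = q ^ (2 * i + 2)" "q * q ^ (2 * i) = q ^ (2 * i + 1)" for i
    by (simp_all add: power_add power2_eq_square mult_ac)
  then show ?thesis
    unfolding cq_def cq_ratio_def wp_factor_def qpoch_def
    by (simp add: prod_dividef prod.distrib prod_power_distrib mult_ac flip: power_mult power_add
        del: power_Suc)
qed

text \<open>Inverting \<open>a\<close> swaps the paired q-shifted factorials. Hence the modulus
  \<open>1 - a q^n\<close>, which says \<open>1/a = q^n\<close>, can be treated like
  \<open>a - q^n\<close>.\<close>

lemma cq_inverse: "cq (1 / a) q k = cq a q k" for a :: "'a::field"
  unfolding cq_def by (simp add: mult_ac)

lemma qint_closed: "(1 - q) * qint q n = 1 - q ^ n"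
  by (simp add: qint_def one_diff_power_eq)

lemma qpoch_Suc: "qpoch x q (Suc n) = qpoch x q n * (1 - x * q ^ n)"
  by (simp add: qpoch_def)

lemma qpoch_Suc_shift: "qpoch x q (Suc n) = (1 - x) * qpoch (x * q) q n"
  unfolding qpoch_def by (subst prod.lessThan_Suc_shift) (simp add: mult_ac)

lemma cq_0 [simp]: "cq a q 0 = 1"
  by (simp add: cq_def qpoch_def qint_def)

text \<open>The right-hand side is a Wilf--Zeilberger certificate for \<open>\<Sum>k. cq b q k\<close>.\<close>

lemma cq_shift_telescope:
  fixes b q :: "'a::field"
  assumes q: "q \<noteq> 0" "\<And>i. i > 0 \<Longrightarrow> q ^ i \<noteq> 1"
    and b: "b \<noteq> 0" "\<And>i. b * q ^ (2 * i) \<noteq> 1" "\<And>i. b \<noteq> q ^ (2 * i)"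
  shows "(\<Sum>k\<le>K. q * (1 - b) * cq (b * q^2) q k - (1 - b * q^2) * cq b q k) =
    - (1 + b * q) / (1 - q) * (qpoch (b * q^3) (q^2) K * qpoch (q / b) (q^2) K * (qpoch q (q^2) (Suc K))^2 /
      (qpoch (b * q^4) (q^2) K * qpoch (q^2 / b) (q^2) K * (qpoch (q^2) (q^2) K)^2))"
proof (induction K)
  case 0
  have "q \<noteq> 1" using q(2)[of 1] by simp
  then show ?case
    by (simp add: qpoch_def field_simps power2_eq_square)
next
  case (Suc k)
  \<comment> \<open>With \<open>x = q^(2k)\<close> every new factor is rational in \<open>b\<close>,
    \<open>q\<close>, \<open>x\<close>, so the induction step becomes an identity in these
    variables.\<close>
  define x where "x = (q^2)^k"
  define A B C D E G where "A = qpoch (b * q^3) (q^2) k" and "B = qpoch (q / b) (q^2) k"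
    and "C = qpoch q (q^2) k" and "D = qpoch (b * q^4) (q^2) k" and "E = qpoch (q^2 / b) (q^2) k"
    and "G = qpoch (q^2) (q^2) k"
  have nz: "1 - q \<noteq> 0" "1 - b \<noteq> 0" "1 - b * q^2 \<noteq> 0" "1 - b * q^4 * x \<noteq> 0" "b - q^2 * x \<noteq> 0" "1 - q^2 * x \<noteq> 0"
    using q(2)[of 1] b(2)[of 0] b(2)[of 1] b(2)[of "2 + k"] b(3)[of "Suc k"] q(2)[of "2 * Suc k"]
    unfolding x_def power_mult[symmetric] by (simp_all add: power_add mult_ac eval_nat_numeral)
  have "b * q^4 * (q^2)^i \<noteq> 1" for i
    using b(2)[of "2 + i"] by (simp only: distrib_left power_add) (simp add: mult.assoc flip: power_mult)
  then have "D \<noteq> 0"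
    unfolding D_def qpoch_def by auto
  have "E \<noteq> 0"
    unfolding E_def qpoch_def using b(3)[of "1 + i" for i] b(1)
    by (auto simp: power_mult[symmetric] power_add[symmetric] field_simps)
  have "G \<noteq> 0"
    unfolding G_def qpoch_def using q(2)[of "2 + 2 * i" for i]
    by (auto simp: power_mult[symmetric] power_add[symmetric] field_simps)
  \<comment> \<open>Shifting \<open>b\<close> by \<open>q^2\<close> changes only the end factors of
    the products; \<open>M\<close> is what both terms at \<open>k + 1\<close> and both certificate
    values have in common.\<close>
  define M where "M = A * B * C^2 * (1 - q * x)^2 / (D * E * G^2 * (1 - q^2 * x)^2)"
  define Q where "Q = qint q (4 * Suc k + 1)"
  have Q: "Q = (1 - q^5 * x^2) / (1 - q)"
    using qint_closed[of q "4 * Suc k + 1"] nz(1)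
    by (simp add: Q_def x_def field_simps power_add flip: power_mult)
  have q3: "b * q * q^2 = b * q^3" "b * q^2 * q = b * q^3" "b * q^2 * q^2 = b * q^4"
    by (simp_all add: power2_eq_square eval_nat_numeral)
  have c1: "cq (b * q^2) q (Suc k) = Q * M * ((1 - b * q^3 * x) * (1 - 1 / (q * b)) / ((1 - b * q^4 * x) * (1 - 1 / b)))"
  proof -
    have e1: "qpoch (b * q^2 * q) (q^2) (Suc k) = A * (1 - b * q^3 * x)"
      unfolding q3 by (simp add: qpoch_Suc A_def x_def)
    have e2: "qpoch (q / (b * q^2)) (q^2) (Suc k) = (1 - 1 / (q * b)) * B"
      using q(1) b(1) by (simp add: qpoch_Suc_shift B_def power2_eq_square mult_ac)
    have e3: "qpoch (b * q^2 * q^2) (q^2) (Suc k) = D * (1 - b * q^4 * x)"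
      unfolding q3 by (simp add: qpoch_Suc D_def x_def)
    have e4: "qpoch (q^2 / (b * q^2)) (q^2) (Suc k) = (1 - 1 / b) * E"
      using q(1) b(1) by (simp add: qpoch_Suc_shift E_def)
    show ?thesis
      unfolding cq_def Q_def[symmetric] M_def e1 e2 e3 e4
      by (simp add: qpoch_Suc C_def[symmetric] G_def[symmetric] x_def[symmetric] power_mult_distrib mult_ac)
  qed
  have c2: "cq b q (Suc k) = Q * M * ((1 - b * q) * (1 - q * x / b) / ((1 - b * q^2) * (1 - q^2 * x / b)))"
  proof -
    have e1: "qpoch (b * q) (q^2) (Suc k) = (1 - b * q) * A"
      unfolding A_def q3(1)[symmetric] by (rule qpoch_Suc_shift)
    have e2: "qpoch (q / b) (q^2) (Suc k) = B * (1 - q * x / b)"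
      by (simp add: qpoch_Suc B_def x_def)
    have e3: "qpoch (b * q^2) (q^2) (Suc k) = (1 - b * q^2) * D"
      unfolding D_def q3(3)[symmetric] by (rule qpoch_Suc_shift)
    have e4: "qpoch (q^2 / b) (q^2) (Suc k) = E * (1 - q^2 * x / b)"
      by (simp add: qpoch_Suc E_def x_def)
    show ?thesis
      unfolding cq_def Q_def[symmetric] M_def e1 e2 e3 e4
      by (simp add: qpoch_Suc C_def[symmetric] G_def[symmetric] x_def[symmetric] power_mult_distrib mult_ac)
  qed
  have r0: "A * B * (qpoch q (q^2) (Suc k))^2 / (D * E * G^2) = M * (1 - q^2 * x)^2"
    using nz(6) by (simp add: M_def qpoch_Suc C_def[symmetric] x_def[symmetric] power_mult_distrib mult_ac)
  have r1: "qpoch (b * q^3) (q^2) (Suc k) * qpoch (q / b) (q^2) (Suc k) * (qpoch q (q^2) (Suc (Suc k)))^2 /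
      (qpoch (b * q^4) (q^2) (Suc k) * qpoch (q^2 / b) (q^2) (Suc k) * (qpoch (q^2) (q^2) (Suc k))^2) =
      M * ((1 - b * q^3 * x) * (1 - q * x / b) * (1 - q^3 * x)^2 / ((1 - b * q^4 * x) * (1 - q^2 * x / b)))"
  proof -
    have "qpoch q (q^2) (Suc (Suc k)) = C * (1 - q * x) * (1 - q^3 * x)"
      by (simp add: qpoch_Suc C_def x_def power2_eq_square eval_nat_numeral mult_ac)
    then show ?thesis
      unfolding M_def
      by (simp add: qpoch_Suc[of _ _ k] A_def[symmetric] B_def[symmetric] D_def[symmetric] E_def[symmetric]
        G_def[symmetric] x_def[symmetric] power_mult_distrib mult_ac)
  qed
  \<comment> \<open>The induction step with \<open>M\<close> cancelled.\<close>
  have key: "q * (1 - b) * (Q * ((1 - b * q^3 * x) * (1 - 1 / (q * b)) / ((1 - b * q^4 * x) * (1 - 1 / b))))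
     - (1 - b * q^2) * (Q * ((1 - b * q) * (1 - q * x / b) / ((1 - b * q^2) * (1 - q^2 * x / b))))
    = - (1 + b * q) / (1 - q) * ((1 - b * q^3 * x) * (1 - q * x / b) * (1 - q^3 * x)^2 / ((1 - b * q^4 * x) * (1 - q^2 * x / b))
      - (1 - q^2 * x)^2)" (is "?L = ?R")
  proof -
    define u v where "u = 1 - b * q^4 * x" and "v = b - q^2 * x"
    have uv: "u \<noteq> 0" "v \<noteq> 0" using nz by (simp_all add: u_def v_def)
    have a1: "(1 - b) * ((1 - 1 / (q * b)) / (u * (1 - 1 / b))) = (1 - q * b) / (q * u)"
      using nz(2) q(1) b(1) uv by (simp add: divide_simps) (simp add: algebra_simps)
    have a2: "(1 - q * x / b) / (1 - q^2 * x / b) = (b - q * x) / v"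
      using b(1) by (simp add: v_def divide_simps)
    have "?L = q * (Q * (1 - b * q^3 * x)) * ((1 - b) * ((1 - 1 / (q * b)) / (u * (1 - 1 / b))))
       - (Q * (1 - b * q)) * ((1 - b * q^2) / (1 - b * q^2)) * ((1 - q * x / b) / (1 - q^2 * x / b))"
      unfolding u_def by (simp only: divide_inverse inverse_mult_distrib mult_ac)
    also have "\<dots> = Q * (1 - b * q^3 * x) * (1 - q * b) / u - Q * (1 - b * q) * (b - q * x) / v"
      unfolding a1 a2 using nz(3) q(1) by simp
    also have "\<dots> = Q * (1 - b * q) * ((1 - b * q^3 * x) * v - (b - q * x) * u) / (u * v)"
      using uv by (simp add: field_simps)
    also have "\<dots> = ((1 - q^5 * x^2) * (1 - b * q) * ((1 - b * q^3 * x) * v - (b - q * x) * u)) / ((1 - q) * (u * v))"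
      unfolding Q by simp
    \<comment> \<open>All denominators are cleared; this polynomial identity is what makes the
      certificate work.\<close>
    also have "(1 - q^5 * x^2) * (1 - b * q) * ((1 - b * q^3 * x) * v - (b - q * x) * u) =
       - (1 + b * q) * ((1 - b * q^3 * x) * (b - q * x) * (1 - q^3 * x)^2 - (1 - q^2 * x)^2 * (u * v))"
      unfolding u_def v_def by algebra
    also have "\<dots> / ((1 - q) * (u * v)) = - (1 + b * q) / (1 - q) * ((1 - b * q^3 * x) * ((b - q * x) / v) * (1 - q^3 * x)^2 / u - (1 - q^2 * x)^2)"
      using uv nz(1) by (simp add: divide_simps)
    also have "\<dots> = ?R"
      unfolding a2[symmetric] u_def by simp
    finally show ?thesis .
  qed
  show ?case
    unfolding sum.atMost_Suc Suc.IH A_def[symmetric] B_def[symmetric] D_def[symmetric] E_def[symmetric] G_def[symmetric]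
      r0 r1 c1 c2 using arg_cong[OF key, of "\<lambda>z. M * z"] by (simp add: algebra_simps)
qed

text \<open>For \<open>a = q^(2N+1)\<close> the factor with index \<open>N\<close> of
  \<open>qpoch (q / a) (q^2) k\<close> is \<open>1 - q^(2N+1) / a = 0\<close>.\<close>

lemma cq_eq_0:
  fixes q :: "'a::field"
  assumes "q \<noteq> 0" "k > N"
  shows "cq (q ^ (2 * N + 1)) q k = 0"
proof -
  have "qpoch (q / q ^ (2 * N + 1)) (q^2) k = 0"
    unfolding qpoch_def using assms by (auto intro!: bexI[of _ N] simp flip: power_mult)
  then show ?thesis by (simp add: cq_def)
qed

text \<open>Raising \<open>N\<close> by one multiplies the parameter \<open>b = q^(2N+1)\<close> by
  \<open>q^2\<close>, so \<open>cq_shift_telescope\<close> yields a first-order recurrence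
  \<open>q (1 - b) S(N+1) = (1 - b q^2) S(N)\<close>, which the closed form satisfies.\<close>

lemma sum_cq_terminating:
  fixes q :: "'a::field"
  assumes q: "q \<noteq> 0" "\<And>i. i > 0 \<Longrightarrow> q ^ i \<noteq> 1"
  shows "(\<Sum>k\<le>N. cq (q ^ (2 * N + 1)) q k) = qint q (2 * N + 1) / q ^ N"
proof (induction N)
  case 0
  then show ?case by (simp add: qint_def)
next
  case (Suc N)
  define b where "b = q ^ (2 * N + 1)"
  have b1: "b * q ^ (2 * i) \<noteq> 1" for i
    using q(2)[of "2 * N + 1 + 2 * i"] by (simp add: b_def power_add mult_ac)
  \<comment> \<open>\<open>b\<close> is an odd power of \<open>q\<close>, and different exponents
    give different powers.\<close>
  have b2: "b \<noteq> q ^ (2 * i)" for i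
  proof
    assume eq: "b = q ^ (2 * i)"
    have "q ^ m = q ^ l \<Longrightarrow> m < l \<Longrightarrow> False" for m l
      using q(2)[of "l - m"] q(1) power_add[of q m "l - m"] by simp
    moreover have "2 * N + 1 \<noteq> 2 * i" by presburger
    ultimately show False
      using eq unfolding b_def by (metis linorder_neqE_nat)
  qed
  have bs: "b * q^2 = q ^ (2 * Suc N + 1)" by (simp add: b_def power_add power2_eq_square)
  \<comment> \<open>The certificate at \<open>Suc N\<close> vanishes: its factor with index
    \<open>N\<close> is \<open>1 - q^(2N+1) / b = 0\<close>.\<close>
  have "qpoch (q / b) (q^2) (Suc N) = 0"
    unfolding qpoch_def b_def using q(1) by (auto intro!: bexI[of _ N] simp flip: power_mult)
  then have "(\<Sum>k\<le>Suc N. q * (1 - b) * cq (b * q^2) q k - (1 - b * q^2) * cq b q k) = 0"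
    using cq_shift_telescope[OF q, of b "Suc N"] b1 b2 q(1) by (simp add: b_def)
  \<comment> \<open>The two sums have different natural ends; the sum for \<open>b\<close> may run
    one index further.\<close>
  moreover have "cq b q (Suc N) = 0"
    unfolding b_def using q(1) by (intro cq_eq_0) auto
  ultimately have "q * (1 - b) * (\<Sum>k\<le>Suc N. cq (b * q^2) q k) = (1 - b * q^2) * (\<Sum>k\<le>N. cq b q k)"
    by (simp add: sum_subtractf flip: sum_distrib_left)
  also have "\<dots> = (1 - b * q^2) * qint q (2 * N + 1) / q ^ N"
    using Suc.IH by (simp add: b_def)
  also have "\<dots> = (1 - q) * qint q (2 * Suc N + 1) * qint q (2 * N + 1) / q ^ N"
    unfolding qint_closed bs ..
  also have "\<dots> = q * (1 - b) * (qint q (2 * Suc N + 1) / q ^ Suc N)"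
    using q(1) by (simp only: b_def flip: qint_closed) simp
  finally have "q * (1 - b) * (\<Sum>k\<le>Suc N. cq (b * q^2) q k) = q * (1 - b) * (qint q (2 * Suc N + 1) / q ^ Suc N)" .
  then show ?case
    using b1[of 0] q(1) unfolding bs mult_cancel_left by simp
qed

section \<open>Local rings\<close>

text \<open>The localization of the polynomial ring at the denominators coprime to
  \<open>P\<close>.\<close>

definition local_ring :: "rat poly poly \<Rightarrow> rat poly poly fract set" where
  "local_ring P = {to_fract U / to_fract V | U V. V \<noteq> 0 \<and> coprime V P}"

text \<open>These are the units of \<open>local_ring P\<close>, the elements by which a congruence
  may be divided.\<close>

definition local_units :: "rat poly poly \<Rightarrow> rat poly poly fract set" where
  "local_units P = {to_fract U / to_fract V | U V. U \<noteq> 0 \<and> V \<noteq> 0 \<and> coprime U P \<and> coprime V P}"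

lemma local_ringI: "V \<noteq> 0 \<Longrightarrow> coprime V P \<Longrightarrow> to_fract U / to_fract V \<in> local_ring P"
  unfolding local_ring_def by blast

lemma local_ringE:
  assumes "x \<in> local_ring P"
  obtains U V where "V \<noteq> 0" "coprime V P" "x = to_fract U / to_fract V"
  using assms unfolding local_ring_def by blast

lemma local_unitsI:
  "U \<noteq> 0 \<Longrightarrow> V \<noteq> 0 \<Longrightarrow> coprime U P \<Longrightarrow> coprime V P \<Longrightarrow> to_fract U / to_fract V \<in> local_units P"
  unfolding local_units_def by blast

lemma local_unitsE:
  assumes "x \<in> local_units P"
  obtains U V where "U \<noteq> 0" "V \<noteq> 0" "coprime U P" "coprime V P" "x = to_fract U / to_fract V"
  using assms unfolding local_units_def by blast

lemma to_fract_in_local_ring [simp]: "to_fract U \<in> local_ring P"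
  using local_ringI[of 1 P U] by simp

lemma local_ring_0 [simp]: "0 \<in> local_ring P" and local_ring_1 [simp]: "1 \<in> local_ring P"
  using to_fract_in_local_ring[of 0] to_fract_in_local_ring[of 1] by simp_all

lemma to_fract_in_local_units: "U \<noteq> 0 \<Longrightarrow> coprime U P \<Longrightarrow> to_fract U \<in> local_units P"
  using local_unitsI[of U 1 P] by simp

lemma local_units_1 [simp]: "1 \<in> local_units P"
  using to_fract_in_local_units[of 1] by simp

lemma local_units_subset: "x \<in> local_units P \<Longrightarrow> x \<in> local_ring P"
  by (auto elim!: local_unitsE intro: local_ringI)

lemma local_units_nonzero: "x \<in> local_units P \<Longrightarrow> x \<noteq> 0"
  by (auto elim!: local_unitsE)

lemma local_ring_add [simp]:
  assumes "x \<in> local_ring P" "y \<in> local_ring P"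
  shows "x + y \<in> local_ring P"
proof -
  from assms(1) obtain U V where 1: "V \<noteq> 0" "coprime V P" "x = to_fract U / to_fract V" by (rule local_ringE)
  from assms(2) obtain U' V' where 2: "V' \<noteq> 0" "coprime V' P" "y = to_fract U' / to_fract V'" by (rule local_ringE)
  have "x + y = to_fract (U * V' + U' * V) / to_fract (V * V')"
    using 1 2 by (simp add: field_simps)
  also have "\<dots> \<in> local_ring P"
    using 1 2 by (intro local_ringI) simp_all
  finally show ?thesis .
qed

lemma local_ring_mult [simp]:
  assumes "x \<in> local_ring P" "y \<in> local_ring P"
  shows "x * y \<in> local_ring P"
proof -
  from assms(1) obtain U V where 1: "V \<noteq> 0" "coprime V P" "x = to_fract U / to_fract V" by (rule local_ringE)
  from assms(2) obtain U' V' where 2: "V' \<noteq> 0" "coprime V' P" "y = to_fract U' / to_fract V'" by (rule local_ringE)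
  have "x * y = to_fract (U * U') / to_fract (V * V')"
    using 1 2 by simp
  also have "\<dots> \<in> local_ring P"
    using 1 2 by (intro local_ringI) simp_all
  finally show ?thesis .
qed

lemma local_units_mult:
  assumes "x \<in> local_units P" "y \<in> local_units P"
  shows "x * y \<in> local_units P"
proof -
  from assms(1) obtain U V where 1: "U \<noteq> 0" "V \<noteq> 0" "coprime U P" "coprime V P" "x = to_fract U / to_fract V"
    by (rule local_unitsE)
  from assms(2) obtain U' V' where 2: "U' \<noteq> 0" "V' \<noteq> 0" "coprime U' P" "coprime V' P" "y = to_fract U' / to_fract V'"
    by (rule local_unitsE)
  have "x * y = to_fract (U * U') / to_fract (V * V')"
    using 1 2 by simp
  also have "\<dots> \<in> local_units P"
    using 1 2 by (intro local_unitsI) simp_all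
  finally show ?thesis .
qed

lemma local_units_inverse: "x \<in> local_units P \<Longrightarrow> inverse x \<in> local_units P"
  by (auto elim!: local_unitsE intro: local_unitsI simp: inverse_eq_divide)

lemma local_units_divide: "x \<in> local_units P \<Longrightarrow> y \<in> local_units P \<Longrightarrow> x / y \<in> local_units P"
  by (simp add: divide_inverse local_units_mult local_units_inverse)

lemma local_ring_divide: "x \<in> local_ring P \<Longrightarrow> y \<in> local_units P \<Longrightarrow> x / y \<in> local_ring P"
  by (simp add: divide_inverse local_units_subset local_units_inverse)

lemma local_ring_uminus [simp]: "x \<in> local_ring P \<Longrightarrow> - x \<in> local_ring P"
  using local_ring_mult[OF to_fract_in_local_ring[of "- 1"], of x P]
  by (simp only: to_fract_uminus to_fract_1) simp

lemma local_ring_diff [simp]: "x \<in> local_ring P \<Longrightarrow> y \<in> local_ring P \<Longrightarrow> x - y \<in> local_ring P"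
  using local_ring_add[of x P "- y"] by simp

lemma local_ring_power [simp]: "x \<in> local_ring P \<Longrightarrow> x ^ n \<in> local_ring P"
  by (induction n) simp_all

lemma local_units_power: "x \<in> local_units P \<Longrightarrow> x ^ n \<in> local_units P"
  by (induction n) (simp_all add: local_units_mult)

lemma local_ring_sum: "(\<And>i. i \<in> A \<Longrightarrow> f i \<in> local_ring P) \<Longrightarrow> sum f A \<in> local_ring P"
  by (induction A rule: infinite_finite_induct) simp_all

lemma local_ring_prod: "(\<And>i. i \<in> A \<Longrightarrow> f i \<in> local_ring P) \<Longrightarrow> prod f A \<in> local_ring P"
  by (induction A rule: infinite_finite_induct) simp_all

lemma local_units_prod: "(\<And>i. i \<in> A \<Longrightarrow> f i \<in> local_units P) \<Longrightarrow> prod f A \<in> local_units P"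
  by (induction A rule: infinite_finite_induct) (simp_all add: local_units_mult)

section \<open>Calculus of congruences of rational functions\<close>

text \<open>Congruence is membership of the difference in the ideal generated by \<open>P\<close> in
  \<open>local_ring P\<close>; the rules below follow from its ring structure.\<close>

lemma ratfun_cong_iff: "ratfun_cong x y P \<longleftrightarrow> (\<exists>z\<in>local_ring P. x - y = to_fract P * z)"
  unfolding ratfun_cong_def local_ring_def by blast

lemma ratfun_congI: "z \<in> local_ring P \<Longrightarrow> x - y = to_fract P * z \<Longrightarrow> ratfun_cong x y P"
  unfolding ratfun_cong_iff by blast

lemma ratfun_cong_refl [simp]: "ratfun_cong x x P"
  by (rule ratfun_congI[of 0]) simp_all

lemma ratfun_cong_sym: "ratfun_cong x y P \<Longrightarrow> ratfun_cong y x P"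
  unfolding ratfun_cong_iff by (metis local_ring_uminus minus_diff_eq mult_minus_right)

lemma ratfun_cong_add:
  assumes "ratfun_cong x y P" "ratfun_cong x' y' P"
  shows "ratfun_cong (x + x') (y + y') P"
proof -
  from assms obtain z z' where "z \<in> local_ring P" "x - y = to_fract P * z"
    "z' \<in> local_ring P" "x' - y' = to_fract P * z'"
    unfolding ratfun_cong_iff by blast
  then show ?thesis
    by (intro ratfun_congI[of "z + z'"]) (simp_all add: distrib_left add_diff_add flip: \<open>x - y = _\<close>)
qed

lemma ratfun_cong_trans [trans]: "ratfun_cong x y P \<Longrightarrow> ratfun_cong y z P \<Longrightarrow> ratfun_cong x z P"
  using ratfun_cong_add[of x y P "y - y" "z - y"] ratfun_cong_add[of y z P "- y" "- y"]
  by (simp add: ratfun_cong_sym)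

lemma ratfun_cong_mult:
  assumes "ratfun_cong x y P" "ratfun_cong x' y' P" "x \<in> local_ring P" "y' \<in> local_ring P"
  shows "ratfun_cong (x * x') (y * y') P"
proof -
  from assms obtain z z' where z: "z \<in> local_ring P" "x - y = to_fract P * z"
    "z' \<in> local_ring P" "x' - y' = to_fract P * z'"
    unfolding ratfun_cong_iff by blast
  have "x * x' - y * y' = x * (x' - y') + (x - y) * y'" by (simp add: algebra_simps)
  also have "\<dots> = to_fract P * (x * z' + z * y')"
    unfolding z by (simp add: algebra_simps)
  finally show ?thesis
    using assms z by (intro ratfun_congI[of "x * z' + z * y'"]) simp_all
qed

lemma ratfun_cong_local_ring: "ratfun_cong x y P \<Longrightarrow> x \<in> local_ring P \<Longrightarrow> y \<in> local_ring P"
proof -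
  assume "ratfun_cong x y P" "x \<in> local_ring P"
  then obtain z where "z \<in> local_ring P" "x - y = to_fract P * z"
    unfolding ratfun_cong_iff by blast
  then have "y = x - to_fract P * z" by (metis diff_diff_eq2 diff_add_cancel add_diff_cancel_left')
  then show "y \<in> local_ring P" using \<open>x \<in> _\<close> \<open>z \<in> _\<close> by simp
qed

lemma ratfun_cong_uminus: "ratfun_cong x y P \<Longrightarrow> ratfun_cong (- x) (- y) P"
  using ratfun_cong_add[OF ratfun_cong_sym ratfun_cong_refl[of "- x - y"]] by fastforce

lemma ratfun_cong_diff:
  "ratfun_cong x y P \<Longrightarrow> ratfun_cong x' y' P \<Longrightarrow> ratfun_cong (x - x') (y - y') P"
  using ratfun_cong_add[of x y P "- x'" "- y'"] by (simp add: ratfun_cong_uminus)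

lemma ratfun_cong_inverse:
  assumes "ratfun_cong x y P" "x \<in> local_units P" "y \<in> local_units P"
  shows "ratfun_cong (inverse x) (inverse y) P"
proof -
  from assms obtain z where z: "z \<in> local_ring P" "x - y = to_fract P * z"
    unfolding ratfun_cong_iff by blast
  have "inverse x - inverse y = - (x - y) * (inverse x * inverse y)"
    using assms(2,3)[THEN local_units_nonzero] by (simp add: field_simps)
  also have "\<dots> = to_fract P * - (z * (inverse x * inverse y))"
    unfolding z by (simp add: algebra_simps)
  finally show ?thesis
    by (rule ratfun_congI[rotated])
       (use assms z in \<open>simp add: local_units_inverse local_units_subset\<close>)
qed

lemma ratfun_cong_divide:
  assumes "ratfun_cong x y P" "ratfun_cong x' y' P" "x \<in> local_ring P"
    "x' \<in> local_units P" "y' \<in> local_units P"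
  shows "ratfun_cong (x / x') (y / y') P"
  unfolding divide_inverse using assms
  by (intro ratfun_cong_mult ratfun_cong_inverse) (simp_all add: local_units_inverse local_units_subset)

lemma ratfun_cong_power:
  assumes "ratfun_cong x y P" "x \<in> local_ring P"
  shows "ratfun_cong (x ^ k) (y ^ k) P"
  by (induction k) (use assms in \<open>simp_all add: ratfun_cong_mult ratfun_cong_local_ring\<close>)

lemma ratfun_cong_sum:
  "(\<And>i. i \<in> A \<Longrightarrow> ratfun_cong (f i) (g i) P) \<Longrightarrow> ratfun_cong (sum f A) (sum g A) P"
  by (induction A rule: infinite_finite_induct) (simp_all add: ratfun_cong_add)

lemma ratfun_cong_prod:
  assumes "\<And>i. i \<in> A \<Longrightarrow> ratfun_cong (f i) (g i) P" "\<And>i. i \<in> A \<Longrightarrow> f i \<in> local_ring P"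
  shows "ratfun_cong (prod f A) (prod g A) P"
  using assms
proof (induction A rule: infinite_finite_induct)
  case (insert i A)
  have "prod g A \<in> local_ring P"
    using insert.prems by (intro local_ring_prod) (metis insertI2 ratfun_cong_local_ring)
  then show ?case
    using insert by (simp add: ratfun_cong_mult)
qed simp_all

lemma ratfun_cong_0_mult:
  assumes "ratfun_cong x 0 P" "y \<in> local_ring P"
  shows "ratfun_cong (x * y) 0 P"
proof -
  from assms obtain z where z: "z \<in> local_ring P" "x = to_fract P * z"
    unfolding ratfun_cong_iff by auto
  then show ?thesis
    using assms(2) by (intro ratfun_congI[of "z * y"]) (simp_all add: mult_ac)
qed

text \<open>A denominator coprime to \<open>P\<close> has its square coprime to \<open>P^2\<close>.
  This is the source of the second factor \<open>\<Phi>_n\<close> in the final modulus.\<close>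

lemma ratfun_cong_0_power2:
  assumes "ratfun_cong x 0 P"
  shows "ratfun_cong (x^2) 0 (P^2)"
proof -
  from assms obtain U V where UV: "V \<noteq> 0" "coprime V P" "x = to_fract P * (to_fract U / to_fract V)"
    unfolding ratfun_cong_def by auto
  have "x^2 = to_fract (P^2) * (to_fract (U^2) / to_fract (V^2))"
    unfolding UV by (simp add: power2_eq_square)
  moreover have "coprime (V^2) (P^2)"
    using UV by simp
  ultimately show ?thesis
    using UV(1) unfolding ratfun_cong_def by (metis diff_zero power_not_zero)
qed

lemma ratfun_cong_0_if_dvd: 
  "P dvd U \<Longrightarrow> ratfun_cong (to_fract U) 0 P"
  by (auto elim!: dvdE intro: ratfun_congI[OF to_fract_in_local_ring])

text \<open>Write \<open>x - y\<close> in lowest terms as \<open>X / Y\<close>. Congruence modulo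
  \<open>R\<close> forces \<open>R\<close> to divide \<open>X\<close> and \<open>Y\<close> to be
  coprime to \<open>R\<close>, and both properties pass to a product of coprime moduli.\<close>

lemma ratfun_cong_coprime_mult:
  assumes "ratfun_cong x y P" "ratfun_cong x y Q" "coprime P Q"
  shows "ratfun_cong x y (P * Q)"
proof -
  obtain X Y where XY: "x - y = to_fract X / to_fract Y" "coprime X Y" "Y \<noteq> 0"
    using that[of "fst (quot_of_fract (x - y))" "snd (quot_of_fract (x - y))"]
    by (simp add: coprime_quot_of_fract flip: Fract_conv_to_fract)
  have *: "R dvd X \<and> coprime Y R" if cong: "ratfun_cong x y R" for R
  proof -
    from cong obtain U V where UV: "V \<noteq> 0" "coprime V R" "x - y = to_fract R * (to_fract U / to_fract V)"
      unfolding ratfun_cong_def by blast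
    have "to_fract (X * V) = to_fract (R * U * Y)"
      using UV(1,3) XY(1,3) by (simp add: field_simps)
    then have eq: "X * V = R * U * Y"
      unfolding to_fract_eq_iff .
    have "R dvd X"
      using UV(2) eq by (metis coprime_commute coprime_dvd_mult_left_iff dvd_triv_left mult.assoc)
    moreover have "Y dvd V"
      using XY(2) eq by (metis coprime_commute coprime_dvd_mult_right_iff dvd_triv_right)
    ultimately show ?thesis
      using UV(2) by (auto intro: coprime_divisors[of Y V R R])
  qed
  have "P * Q dvd X"
    using *[OF assms(1)] *[OF assms(2)] assms(3) by (simp add: divides_mult)
  then obtain U where U: "X = P * Q * U" ..
  show ?thesis
    unfolding ratfun_cong_def
    by (intro exI[of _ U] exI[of _ Y]) (use XY U * assms in auto)
qed

lemma ratfun_cong_prod_coprime: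
  assumes "finite A" "\<And>i. i \<in> A \<Longrightarrow> ratfun_cong x y (f i)" "ratfun_cong x y Q"
    "\<And>i j. i \<in> A \<Longrightarrow> j \<in> A \<Longrightarrow> i \<noteq> j \<Longrightarrow> coprime (f i) (f j)" "\<And>i. i \<in> A \<Longrightarrow> coprime (f i) Q"
  shows "ratfun_cong x y (prod f A * Q)"
  using assms
proof (induction A rule: finite_induct)
  case (insert i A)
  have "coprime (f i) (prod f A * Q)"
    using insert by (auto intro!: prod_coprime_right)
  then show ?case
    using insert by (simp add: ratfun_cong_coprime_mult mult.assoc)
qed simp

section \<open>Cyclotomic polynomials\<close>

text \<open>A divisor of a nonzero constant in \<open>a\<close> has degree 0 in \<open>a\<close>,
  and then it divides every coefficient of \<open>L\<close>, among them 1.\<close>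

lemma coprime_const_poly:
  fixes L :: "rat poly poly"
  assumes "coeff L i = 1" "p \<noteq> 0"
  shows "coprime L [:p:]"
proof (rule coprimeI)
  fix D assume D: "D dvd L" "D dvd [:p:]"
  then have "degree D = 0"
    using dvd_imp_degree_le[of D "[:p:]"] assms(2) by simp
  then obtain c where c: "D = [:c:]" by (metis degree_0_id)
  then have "c dvd coeff L i" using D(1) by (simp add: const_poly_dvd_iff)
  then show "is_unit D" using assms(1) c by (simp add: is_unit_const_poly_iff)
qed

lemma coprime_const_const_poly:
  fixes p r :: "rat poly"
  assumes "coprime p r"
  shows "coprime [:p:] [:r:]"
proof (cases "r = 0")
  case True
  then show ?thesis using assms by (simp add: is_unit_const_poly_iff)
next
  case False
  show ?thesis
  proof (rule coprimeI)
    fix D assume D: "D dvd [:p:]" "D dvd [:r:]"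
    then have "degree D = 0"
      using dvd_imp_degree_le[of D "[:r:]"] False by simp
    then obtain c where c: "D = [:c:]" by (metis degree_0_id)
    then show "is_unit D"
      using D assms by (auto simp: is_unit_const_poly_iff dest: coprime_common_divisor)
  qed
qed

abbreviation (input) cpoly :: "rat poly \<Rightarrow> complex poly" where
  "cpoly \<equiv> map_poly of_rat"

text \<open>A nonconstant common divisor would have a complex root by the fundamental theorem of
  algebra.\<close>

lemma coprime_if_no_common_root:
  fixes p r :: "rat poly"
  assumes "\<And>z. poly (cpoly p) z = 0 \<Longrightarrow> poly (cpoly r) z = 0 \<Longrightarrow> False"
  shows "coprime p r"
proof (rule coprimeI)
  fix D assume D: "D dvd p" "D dvd r"
  have root: "poly (cpoly p) z = 0 \<and> poly (cpoly r) z = 0" if "poly (cpoly D) z = 0" for z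
    using D that by (auto elim!: dvdE simp: map_poly_of_rat_mult)
  have "poly (cpoly D) z \<noteq> 0" for z
    using root[of z] assms[of z] by blast
  then have "degree (cpoly D) = 0" and "D \<noteq> 0"
    using fundamental_theorem_of_algebra[of "cpoly D"] constant_degree[of "cpoly D"] by auto
  then show "is_unit D"
    by (simp add: is_unit_iff_degree degree_map_poly)
qed

text \<open>The root is \<open>cis (2 * pi * k / n)\<close> with \<open>k\<close> coprime to
  \<open>n\<close>, so \<open>z ^ m = 1\<close> amounts to \<open>n\<close> dividing
  \<open>m * k\<close>.\<close>

lemma cyclotomic_root:
  assumes "n > 0" "poly (cpoly (cyclotomic n)) z = 0"
  shows "z ^ m = 1 \<longleftrightarrow> n dvd m"
proof -
  obtain k where k: "k \<in> totatives n" "z = cis (2 * pi * real k / real n)"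
    using assms by (auto simp: map_poly_cyclotomic cyclotomic_complex_def poly_prod)
  have "z ^ m = 1 \<longleftrightarrow> (\<exists>i. real m * (2 * pi * real k / real n) = of_int i * (2 * pi))"
    unfolding k(2) by (simp add: DeMoivre cis_eq_1_iff)
  also have "\<dots> \<longleftrightarrow> (\<exists>i. real_of_int (int (m * k)) = real_of_int (i * int n))"
    using assms(1) by (simp add: field_simps)
  also have "\<dots> \<longleftrightarrow> int n dvd int (m * k)"
    unfolding of_int_eq_iff dvd_def by (metis mult.commute)
  also have "\<dots> \<longleftrightarrow> n dvd m"
    using k(1) unfolding int_dvd_int_iff
    by (simp add: totatives_def coprime_dvd_mult_left_iff coprime_commute)
  finally show ?thesis .
qed

lemma cyclotomic_nonzero: "n > 0 \<Longrightarrow> cyclotomic n \<noteq> 0"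
  using map_poly_cyclotomic[of n] by (auto simp: cyclotomic_complex_def)

text \<open>A common root would have both multiplicative orders \<open>d\<close> and
  \<open>e\<close>.\<close>

lemma coprime_cyclotomic:
  assumes "d > 0" "e > 0" "d \<noteq> e"
  shows "coprime (cyclotomic d) (cyclotomic e)"
  using cyclotomic_root[of d _ d] cyclotomic_root[of e _ d] cyclotomic_root[of d _ e] cyclotomic_root[of e _ e] assms
  by (intro coprime_if_no_common_root) (metis dvd_antisym dvd_refl)

lemma cpoly_monom [simp]: "cpoly (monom 1 n) = monom 1 n"
  by (simp add: map_poly_monom)

lemma cpoly_1 [simp]: "cpoly 1 = 1"
  by (intro poly_eqI) (simp add: coeff_map_poly)

lemma cpoly_diff [simp]: "cpoly (p - r) = cpoly p - cpoly r"
  by (intro poly_eqI) (simp add: coeff_map_poly of_rat_diff)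

lemma prod_cyclotomic:
  assumes "n > 0"
  shows "(\<Prod>d | d dvd n. cyclotomic d) = monom 1 n - 1"
proof -
  have "cpoly (\<Prod>d | d dvd n. cyclotomic d) = (\<Prod>d | d dvd n. cyclotomic_complex d)"
    unfolding map_poly_of_rat_prod
    using assms by (intro prod.cong refl map_poly_cyclotomic) (auto intro: Nat.gr0I)
  also have "\<dots> = cpoly (monom 1 n - 1)"
    using assms by (simp add: prod_cyclotomic_complex)
  finally show ?thesis
    unfolding map_poly_of_rat_inject .
qed

lemma cyclotomic_1: "cyclotomic 1 = monom 1 1 - 1"
  using prod_cyclotomic[of 1] by simp

text \<open>Multiplied by \<open>\<Phi>_1 = q - 1\<close>, both sides become
  \<open>q^n - 1\<close>.\<close>

lemma qint_eq_prod_cyclotomic: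
  assumes "n > 0"
  shows "qint (monom 1 1) n = (\<Prod>d | d dvd n \<and> d \<noteq> 1. cyclotomic d)"
proof -
  have "{d. d dvd n} = insert 1 {d. d dvd n \<and> d \<noteq> 1}" by auto
  moreover have "finite {d. d dvd n \<and> d \<noteq> 1}"
    using assms by simp
  ultimately have "cyclotomic 1 * (\<Prod>d | d dvd n \<and> d \<noteq> 1. cyclotomic d) = monom 1 n - 1"
    using prod_cyclotomic[OF assms] by (metis (mono_tags, lifting) mem_Collect_eq prod.insert)
  also have "\<dots> = cyclotomic 1 * qint (monom 1 1) n"
    using qint_closed[of "monom 1 1 :: rat poly" n]
    unfolding cyclotomic_1 by (simp add: monom_power algebra_simps)
  finally show ?thesis
    using cyclotomic_nonzero[of 1] by simp
qed

section \<open>Passage to polynomials and rational functions in \<open>q\<close> and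
  \<open>a\<close>\<close>

lemma pol_q_power: "pol_q ^ i = [:monom 1 i:]"
  by (induction i) (simp_all add: pol_q_def monom_Suc one_pCons)

lemma qint_pol_q: "qint pol_q n = [:qint (monom 1 1) n:]"
  by (induction n) (simp_all add: qint_def pol_q_power monom_power)

lemma prod_const_poly: "(\<Prod>i\<in>A. [:f i:]) = [:\<Prod>i\<in>A. f i:]" for f :: "'b \<Rightarrow> 'a::comm_ring_1"
  by (induction A rule: infinite_finite_induct) (simp_all add: one_pCons)

lemma to_fract_power: "to_fract (x ^ n) = to_fract x ^ n"
  by (induction n) simp_all

lemma rat_q_power: "rat_q ^ i = to_fract (pol_q ^ i)"
  by (simp add: rat_q_def to_fract_power)

lemma rat_q_nonzero [simp]: "rat_q \<noteq> 0"
  and rat_a_nonzero [simp]: "rat_a \<noteq> 0"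
  by (simp_all add: rat_q_def rat_a_def pol_q_def pol_a_def)

lemma pol_q_power_neq_1:
  assumes "i > 0"
  shows "pol_q ^ i \<noteq> 1"
  using assms degree_monom_eq[of "1::rat" i] by (auto simp: pol_q_power one_pCons)

lemma rat_q_power_neq_1: "i > 0 \<Longrightarrow> rat_q ^ i \<noteq> 1"
  unfolding rat_q_power using pol_q_power_neq_1[of i] by (metis to_fract_1 to_fract_eq_iff)

section \<open>Units modulo a cyclotomic polynomial\<close>

context
  fixes d :: nat
  assumes d: "d > 0"
begin

lemma rat_q_unit_cyclotomic: "rat_q \<in> local_units [:cyclotomic d:]"
proof -
  have "coprime (monom 1 1) (cyclotomic d)"
    using cyclotomic_root[of d 0 d] d zero_power[of d, where 'a = complex]
    by (intro coprime_if_no_common_root) (auto simp: poly_monom)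
  then show ?thesis
    unfolding rat_q_def using pol_q_power[of 1]
    by (intro to_fract_in_local_units) (auto intro: coprime_const_const_poly simp: pol_q_def)
qed

lemma one_minus_rat_q_unit_cyclotomic:
  assumes "\<not> d dvd i"
  shows "1 - rat_q ^ i \<in> local_units [:cyclotomic d:]"
proof -
  have "coprime (1 - monom 1 i) (cyclotomic d)"
    using cyclotomic_root[of d _ i] d assms
    by (intro coprime_if_no_common_root) (auto simp: poly_monom)
  moreover have "1 - pol_q ^ i = [:1 - monom 1 i:]"
    by (simp add: pol_q_power one_pCons)
  moreover have "1 - pol_q ^ i \<noteq> 0"
    using pol_q_power_neq_1[of i] assms by (cases "i = 0") auto
  ultimately have "to_fract (1 - pol_q ^ i) \<in> local_units [:cyclotomic d:]"
    by (intro to_fract_in_local_units) (auto intro: coprime_const_const_poly)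
  then show ?thesis
    by (simp add: rat_q_power)
qed

text \<open>At a common root \<open>z ^ i = -1\<close>, so \<open>d\<close> divides
  \<open>2 * i\<close>, and for odd \<open>d\<close> also \<open>i\<close>; this forces
  \<open>z ^ i = 1\<close>, a contradiction.\<close>

lemma one_plus_rat_q_unit_cyclotomic:
  assumes "odd d"
  shows "1 + rat_q ^ i \<in> local_units [:cyclotomic d:]"
proof -
  have "coprime (1 + monom 1 i) (cyclotomic d)"
  proof (rule coprime_if_no_common_root)
    fix z :: complex
    assume z: "poly (cpoly (1 + monom 1 i)) z = 0" "poly (cpoly (cyclotomic d)) z = 0"
    then have "1 + z ^ i = 0" by (simp add: map_poly_of_rat_add poly_monom)
    then have m: "z ^ i = - 1" by (simp add: add_eq_0_iff)
    then have "z ^ (2 * i) = 1" by (simp add: mult.commute[of 2] power_mult)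
    then have "d dvd i"
      using cyclotomic_root[OF d z(2), of "2 * i"] assms by (simp add: coprime_dvd_mult_right_iff)
    then show False
      using cyclotomic_root[OF d z(2), of i] m by simp
  qed
  moreover have eq: "1 + pol_q ^ i = [:1 + monom 1 i:]"
    by (simp add: pol_q_power one_pCons)
  \<comment> \<open>The value at \<open>q = 1\<close> is 2, so the polynomial is not zero.\<close>
  moreover have "poly (1 + monom 1 i :: rat poly) 1 \<noteq> 0"
    by (simp add: poly_monom)
  then have "1 + pol_q ^ i \<noteq> 0"
    unfolding eq by (metis pCons_eq_0_iff poly_0)
  ultimately have "to_fract (1 + pol_q ^ i) \<in> local_units [:cyclotomic d:]"
    by (intro to_fract_in_local_units) (auto intro: coprime_const_const_poly)
  then show ?thesis
    by (simp add: rat_q_power)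
qed

lemma rat_q_power_cong_1: "ratfun_cong (rat_q ^ d) 1 [:cyclotomic d:]"
proof -
  have "cyclotomic d dvd monom 1 d - 1"
    unfolding prod_cyclotomic[OF d, symmetric]
    using d by (intro dvd_prodI) auto
  then have "[:cyclotomic d:] dvd pol_q ^ d - 1"
    by (simp add: pol_q_power one_pCons)
  from ratfun_cong_0_if_dvd[OF this] show ?thesis
    unfolding ratfun_cong_iff by (simp add: rat_q_power)
qed

end

text \<open>As polynomials in \<open>a\<close> these elements have a coefficient 1, so
  \<open>coprime_const_poly\<close> applies.\<close>

lemma rat_a_units_const:
  assumes "p \<noteq> 0"
  shows "rat_a \<in> local_units [:p:]"
    and "1 - rat_a * rat_q ^ i \<in> local_units [:p:]"
    and "rat_a - rat_q ^ i \<in> local_units [:p:]"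
proof -
  have "to_fract pol_a \<in> local_units [:p:]" "to_fract (1 - pol_a * pol_q ^ i) \<in> local_units [:p:]"
    "to_fract (pol_a - pol_q ^ i) \<in> local_units [:p:]"
    using coprime_const_poly[of pol_a 1 p] coprime_const_poly[of "1 - pol_a * pol_q ^ i" 0 p]
      coprime_const_poly[of "pol_a - pol_q ^ i" 1 p] assms
    by (auto intro!: to_fract_in_local_units simp: pol_a_def pol_q_power one_pCons)
  then show "rat_a \<in> local_units [:p:]" "1 - rat_a * rat_q ^ i \<in> local_units [:p:]"
    "rat_a - rat_q ^ i \<in> local_units [:p:]"
    by (simp_all add: rat_a_def rat_q_power)
qed

section \<open>Congruences modulo a cyclotomic polynomial\<close>

text \<open>The quotient is a Gaussian binomial coefficient; its integrality follows from the
  q-Pascal rule by induction on \<open>m + k\<close>.\<close>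

lemma qpoch_mult_dvd: "qpoch x x m * qpoch x x k dvd qpoch x x (m + k)"
  for x :: "'a::comm_ring_1"
proof (induction "m + k" arbitrary: m k)
  case (Suc s)
  show ?case
  proof (cases "m = 0 \<or> k = 0")
    case True
    then show ?thesis by (auto simp: qpoch_def)
  next
    case False
    then obtain m' k' where mk: "m = Suc m'" "k = Suc k'"
      by (meson not0_implies_Suc)
    have s: "s = m' + Suc k'" "s = Suc m' + k'"
      using Suc.hyps(2) mk by simp_all
    define B where "B = qpoch x x m * qpoch x x k"
    have 1: "B dvd qpoch x x s * (1 - x * x ^ m')"
      using mult_dvd_mono[OF Suc.hyps(1)[OF s(1)] dvd_refl[of "1 - x * x ^ m'"]]
      unfolding B_def mk s(1)[symmetric] by (simp add: qpoch_Suc mult_ac)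
    have 2: "B dvd qpoch x x s * (1 - x * x ^ k')"
      using mult_dvd_mono[OF Suc.hyps(1)[OF s(2)] dvd_refl[of "1 - x * x ^ k'"]]
      unfolding B_def mk s(2)[symmetric] by (simp add: qpoch_Suc mult_ac)
    have "x * x ^ s = x ^ m * (x * x ^ k')"
      by (simp add: mk s(1) power_add mult_ac)
    \<comment> \<open>The q-Pascal rule, from
      \<open>1 - x^(m+k) = (1 - x^m) + x^m (1 - x^k)\<close>.\<close>
    then have "qpoch x x (m + k) = qpoch x x s * (1 - x * x ^ m') + x ^ m * (qpoch x x s * (1 - x * x ^ k'))"
      unfolding Suc.hyps(2)[symmetric] qpoch_Suc by (simp add: mk algebra_simps)
    then show ?thesis
      using dvd_add[OF 1 dvd_mult[OF 2]] by (simp add: B_def)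
  qed
qed (simp add: qpoch_def)

lemma to_fract_prod: "to_fract (prod f A) = (\<Prod>i\<in>A. to_fract (f i))"
  by (induction A rule: infinite_finite_induct) simp_all

lemma to_fract_qpoch: "to_fract (qpoch x y m) = qpoch (to_fract x) (to_fract y) m"
  by (simp add: qpoch_def to_fract_prod to_fract_power)

lemma qpoch_double:
  "qpoch q q (2 * k) = (\<Prod>i<k. 1 - q ^ (2 * i + 1)) * (\<Prod>i<k. 1 - q ^ (2 * i + 2))"
  for q :: "'a::comm_ring_1"
  by (induction k) (simp_all add: qpoch_def mult_ac)

lemma prod_lessThan_add: "prod f {..<j + k} = prod f {..<j} * (\<Prod>i<k. f (j + i))" for f :: "nat \<Rightarrow> 'a::comm_monoid_mult"
  by (induction k) (simp_all add: mult_ac)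

section \<open>Integrality of the terms modulo \<open>\<Phi>_d\<close> for odd
  \<open>d > 1\<close>\<close>

context
  fixes d m :: nat and P :: "rat poly poly"
  assumes d: "d = 2 * m + 1" and m: "m > 0" and P: "P = [:cyclotomic d:]"
begin

lemma cyclotomic_index_pos: "d > 0" "d > 1" "odd d"
  using d m by simp_all

lemma rat_q_unit [simp]: "rat_q \<in> local_units P"
  unfolding P using rat_q_unit_cyclotomic cyclotomic_index_pos by simp

lemma rat_q_local [simp]: "rat_q \<in> local_ring P"
  by (simp add: local_units_subset)

lemma rat_q_power_unit [simp]: "rat_q ^ i \<in> local_units P"
  by (simp add: local_units_power)

lemma one_minus_unit: "\<not> d dvd i \<Longrightarrow> 1 - rat_q ^ i \<in> local_units P"
  unfolding P using one_minus_rat_q_unit_cyclotomic cyclotomic_index_pos by simp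

lemma one_plus_unit: "1 + rat_q ^ i \<in> local_units P"
  unfolding P using one_plus_rat_q_unit_cyclotomic cyclotomic_index_pos by simp

lemma rat_a_units_cyclotomic:
  shows a_unit: "rat_a \<in> local_units P"
    and one_minus_a_unit: "1 - rat_a * rat_q ^ i \<in> local_units P"
    and one_minus_div_a_unit: "1 - rat_q ^ i / rat_a \<in> local_units P"
proof -
  note * = rat_a_units_const[OF cyclotomic_nonzero[OF cyclotomic_index_pos(1)], folded P]
  show "rat_a \<in> local_units P" "1 - rat_a * rat_q ^ i \<in> local_units P"
    by (fact *)+
  have "1 - rat_q ^ i / rat_a = (rat_a - rat_q ^ i) / rat_a"
    by (simp add: field_simps)
  then show "1 - rat_q ^ i / rat_a \<in> local_units P"
    using *(1,3) by (simp add: local_units_divide)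
qed

lemma wp_factor_unit: "\<not> d dvd i \<Longrightarrow> wp_factor rat_a (rat_q ^ i) \<in> local_units P"
  unfolding wp_factor_def
  by (intro local_units_mult local_units_power one_minus_a_unit one_minus_div_a_unit one_minus_unit)

lemma wp_factor_local: "x \<in> local_ring P \<Longrightarrow> wp_factor rat_a x \<in> local_ring P"
  unfolding wp_factor_def by (simp add: local_ring_divide a_unit local_units_subset)

lemma wp_factor_cong:
  assumes "ratfun_cong x y P" "x \<in> local_ring P"
  shows "ratfun_cong (wp_factor rat_a x) (wp_factor rat_a y) P"
proof -
  have y: "y \<in> local_ring P" using assms ratfun_cong_local_ring by blast
  show ?thesis
    unfolding wp_factor_def
    by (intro ratfun_cong_mult ratfun_cong_diff ratfun_cong_refl ratfun_cong_divide ratfun_cong_power)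
       (use assms y in \<open>simp_all add: local_ring_divide a_unit local_units_subset\<close>)
qed

lemma rat_q_power_cong: "ratfun_cong (rat_q ^ (i + d * l)) (rat_q ^ i) P"
proof -
  have "ratfun_cong (rat_q ^ i * (rat_q ^ d) ^ l) (rat_q ^ i * 1 ^ l) P"
    using rat_q_power_cong_1[OF cyclotomic_index_pos(1), folded P]
    by (intro ratfun_cong_mult ratfun_cong_power ratfun_cong_refl) simp_all
  then show ?thesis
    by (simp add: power_add power_mult)
qed

text \<open>For \<open>k \<ge> d\<close> single denominators vanish modulo \<open>\<Phi>_d\<close>,
  but the quotient of the products over odd and even powers is a central Gaussian binomial
  coefficient divided by the square of the product of \<open>1 + q^(i+1)\<close>, a unit since
  \<open>d\<close> is odd. The factors containing \<open>a\<close> are units for every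
  exponent.\<close>

lemma cq_ratio_local: "cq_ratio rat_a rat_q k \<in> local_ring P"
proof -
  define O2 E2 where "O2 = (\<Prod>i<k. 1 - rat_q ^ (2 * i + 1))" and "E2 = (\<Prod>i<k. 1 - rat_q ^ (2 * i + 2))"
  define B C where "B = qpoch rat_q rat_q k" and "C = (\<Prod>i<k. 1 + rat_q ^ (i + 1))"
  have B0: "B \<noteq> 0"
    unfolding B_def qpoch_def using rat_q_power_neq_1[of "Suc i" for i] by simp
  have C: "C \<in> local_units P"
    unfolding C_def by (intro local_units_prod one_plus_unit)
  have E: "E2 = B * C"
    unfolding E2_def B_def C_def qpoch_def prod.distrib[symmetric]
    by (intro prod.cong refl) (simp add: algebra_simps mult_2_right power_add)
  obtain g where g: "qpoch pol_q pol_q (2 * k) = qpoch pol_q pol_q k * qpoch pol_q pol_q k * g"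
    using qpoch_mult_dvd[of pol_q k k] by (auto elim: dvdE simp: mult_2)
  have "qpoch rat_q rat_q (2 * k) = B * B * to_fract g"
    using arg_cong[OF g, of to_fract] by (simp add: to_fract_qpoch rat_q_def B_def)
  then have "O2 * (B * C) = B * B * to_fract g"
    unfolding qpoch_double O2_def[symmetric] E2_def[symmetric] E .
  then have "O2 / E2 = to_fract g / C^2"
    unfolding E using B0 local_units_nonzero[OF C] by (simp add: field_simps power2_eq_square)
  then have OE: "O2 / E2 \<in> local_ring P"
    using C by (simp add: local_ring_divide local_units_power)
  have "cq_ratio rat_a rat_q k = (\<Prod>i<k. (1 - rat_a * rat_q ^ (2 * i + 1)) * (1 - rat_q ^ (2 * i + 1) / rat_a) /
      ((1 - rat_a * rat_q ^ (2 * i + 2)) * (1 - rat_q ^ (2 * i + 2) / rat_a))) * (O2 / E2)^2"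
    unfolding cq_ratio_def wp_factor_def O2_def E2_def
    by (simp add: prod_dividef prod.distrib prod_power_distrib mult_ac power_divide)
  also have "\<dots> \<in> local_ring P"
    by (intro local_ring_mult[OF _ local_ring_power[OF OE]] local_units_subset local_units_prod
        local_units_divide local_units_mult one_minus_a_unit one_minus_div_a_unit)
  finally show ?thesis .
qed

lemma qint_local: "qint rat_q k \<in> local_ring P"
  unfolding qint_def by (intro local_ring_sum) simp

lemma qint_eq: "qint rat_q k = (1 - rat_q ^ k) / (1 - rat_q)"
  using qint_closed[of rat_q k] rat_q_power_neq_1[of 1] by (simp add: field_simps)

lemma one_minus_q_unit: "1 - rat_q \<in> local_units P"
  using one_minus_unit[of 1] cyclotomic_index_pos by simp

lemma cq_local: "cq rat_a rat_q k \<in> local_ring P"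
  unfolding cq_eq by (simp add: cq_ratio_local qint_local)

section \<open>Shift by multiples of \<open>d\<close> and vanishing in the upper half of a
  block\<close>

text \<open>Since \<open>q^d\<close> is congruent to 1, the factors after the first
  \<open>l * d\<close> repeat those at the start, where the denominators are units because
  \<open>k < d\<close>. The first \<open>l * d\<close> factors stay together: only their product is
  known to be integral.\<close>

lemma cq_shift_cong:
  assumes "k < d"
  shows "ratfun_cong (cq rat_a rat_q (l * d + k)) (cq_ratio rat_a rat_q (l * d) * cq rat_a rat_q k) P"
proof -
  have "4 * (l * d + k) + 1 = 4 * k + 1 + d * (4 * l)" by simp
  then have q: "ratfun_cong (qint rat_q (4 * (l * d + k) + 1)) (qint rat_q (4 * k + 1)) P"
    unfolding qint_eq
    by (intro ratfun_cong_divide ratfun_cong_diff) (simp_all only: rat_q_power_cong one_minus_q_unit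
        ratfun_cong_refl local_ring_diff local_ring_1 local_ring_power rat_q_local)
  have f: "ratfun_cong (wp_factor rat_a (rat_q ^ (2 * (l * d + i) + 1)) / wp_factor rat_a (rat_q ^ (2 * (l * d + i) + 2)))
     (wp_factor rat_a (rat_q ^ (2 * i + 1)) / wp_factor rat_a (rat_q ^ (2 * i + 2))) P"
    and f': "wp_factor rat_a (rat_q ^ (2 * (l * d + i) + 1)) / wp_factor rat_a (rat_q ^ (2 * (l * d + i) + 2)) \<in> local_ring P"
    if "i < k" for i
  proof -
    have e: "2 * (l * d + i) + 1 = 2 * i + 1 + d * (2 * l)" "2 * (l * d + i) + 2 = 2 * i + 2 + d * (2 * l)"
      by simp_all
    have "\<not> d dvd i + 1"
      using that assms by (auto dest: dvd_imp_le)
    moreover have "coprime d 2" using cyclotomic_index_pos by simp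
    ultimately have nd: "\<not> d dvd 2 * i + 2"
      using coprime_dvd_mult_right_iff[of d 2 "i + 1"] by simp
    then have nd': "\<not> d dvd 2 * (l * d + i) + 2"
      unfolding e by (simp add: dvd_add_left_iff del: add_2_eq_Suc')
    show "ratfun_cong (wp_factor rat_a (rat_q ^ (2 * (l * d + i) + 1)) / wp_factor rat_a (rat_q ^ (2 * (l * d + i) + 2)))
     (wp_factor rat_a (rat_q ^ (2 * i + 1)) / wp_factor rat_a (rat_q ^ (2 * i + 2))) P"
      by (intro ratfun_cong_divide wp_factor_cong wp_factor_unit nd nd' wp_factor_local)
         (simp_all only: e rat_q_power_cong local_ring_power rat_q_local)
    show "wp_factor rat_a (rat_q ^ (2 * (l * d + i) + 1)) / wp_factor rat_a (rat_q ^ (2 * (l * d + i) + 2)) \<in> local_ring P"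
      by (intro local_ring_divide wp_factor_unit nd' wp_factor_local) simp
  qed
  have "ratfun_cong (\<Prod>i<k. wp_factor rat_a (rat_q ^ (2 * (l * d + i) + 1)) / wp_factor rat_a (rat_q ^ (2 * (l * d + i) + 2)))
      (cq_ratio rat_a rat_q k) P"
    unfolding cq_ratio_def by (intro ratfun_cong_prod f f') auto
  from ratfun_cong_mult[OF ratfun_cong_refl this cq_ratio_local cq_ratio_local, of "l * d"]
  have "ratfun_cong (cq_ratio rat_a rat_q (l * d + k)) (cq_ratio rat_a rat_q (l * d) * cq_ratio rat_a rat_q k) P"
    by (simp only: cq_ratio_def prod_lessThan_add)
  from ratfun_cong_mult[OF q this] show ?thesis
    unfolding cq_eq by (simp add: qint_local cq_ratio_local mult_ac)
qed

lemma local_ring_power2: "local_ring (P^2) = local_ring P"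
  unfolding local_ring_def by (simp add: coprime_power_right_iff)

text \<open>For \<open>k > m\<close> the numerator contains the factor with index \<open>m\<close>,
  whose exponent is \<open>2m + 1 = d\<close>; it contributes \<open>(1 - q^d)^2\<close>. The
  denominator exponents \<open>2i + 2\<close> are not divisible by \<open>d\<close> for
  \<open>i < k < d\<close>.\<close>

lemma cq_cong_0:
  assumes "m < k" "k < d"
  shows "ratfun_cong (cq rat_a rat_q k) 0 (P^2)"
proof -
  let ?G = "\<lambda>i. wp_factor rat_a (rat_q ^ i)"
  have "ratfun_cong (1 - rat_q ^ d) 0 P"
    using ratfun_cong_diff[OF ratfun_cong_refl rat_q_power_cong[of 0 1], of 1] by simp
  then have sq: "ratfun_cong ((1 - rat_q ^ d)^2) 0 (P^2)"
    by (rule ratfun_cong_0_power2)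
  have nd: "\<not> d dvd 2 * i + 2" if "i < k" for i
  proof -
    have "\<not> d dvd i + 1"
      using that assms by (auto dest: dvd_imp_le)
    moreover have "coprime d 2" using cyclotomic_index_pos by simp
    ultimately show ?thesis
      using coprime_dvd_mult_right_iff[of d 2 "i + 1"] by simp
  qed
  have "(\<Prod>i<k. ?G (2 * i + 1)) = ?G d * (\<Prod>i\<in>{..<k} - {m}. ?G (2 * i + 1))"
    using assms d by (subst prod.remove[of _ m]) auto
  then have "cq rat_a rat_q k = (1 - rat_q ^ d)^2 * (qint rat_q (4 * k + 1) *
      ((1 - rat_a * rat_q ^ d) * (1 - rat_q ^ d / rat_a)) * (\<Prod>i\<in>{..<k} - {m}. ?G (2 * i + 1)) / (\<Prod>i<k. ?G (2 * i + 2)))"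
    unfolding cq_eq cq_ratio_def prod_dividef by (simp add: wp_factor_def mult_ac)
  also have "ratfun_cong \<dots> 0 (P^2)"
    by (intro ratfun_cong_0_mult[OF sq], unfold local_ring_power2)
       (intro local_ring_divide local_ring_mult local_ring_prod local_units_prod wp_factor_unit wp_factor_local nd
         qint_local local_units_subset[OF one_minus_a_unit] local_units_subset[OF one_minus_div_a_unit]; simp)
  finally show ?thesis .
qed

section \<open>Reflection of \<open>k\<close> into \<open>m - k\<close>\<close>

text \<open>From \<open>i + j = d\<close> it follows that \<open>q^i\<close> is congruent to
  \<open>1 / q^j\<close>, and \<open>wp_factor\<close> is self-reciprocal up to a fourth
  power.\<close>

lemma wp_factor_reflect_cong:
  assumes "i + j = d"
  shows "ratfun_cong (wp_factor rat_a (rat_q ^ i)) (wp_factor rat_a (rat_q ^ j) / rat_q ^ (4 * j)) P"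
proof -
  have "rat_q ^ i = rat_q ^ (0 + d * 1) / rat_q ^ j"
    by (simp add: power_add flip: assms)
  also have "ratfun_cong \<dots> (rat_q ^ 0 / rat_q ^ j) P"
    by (intro ratfun_cong_divide rat_q_power_cong) simp_all
  finally have "ratfun_cong (rat_q ^ i) (1 / rat_q ^ j) P" by simp
  then have "ratfun_cong (wp_factor rat_a (rat_q ^ i)) (wp_factor rat_a (1 / rat_q ^ j)) P"
    by (intro wp_factor_cong) simp_all
  also have "wp_factor rat_a (1 / x) = wp_factor rat_a x / x ^ 4" if "x \<noteq> 0" for x
    using that by (simp add: wp_factor_def field_simps eval_nat_numeral)
  then have "wp_factor rat_a (1 / rat_q ^ j) = wp_factor rat_a (rat_q ^ j) / rat_q ^ (4 * j)"
    by (simp add: mult.commute[of 4] power_mult)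
  finally show ?thesis .
qed

text \<open>With the denominators in reverse order, the exponents \<open>2i + 1\<close> and
  \<open>2m - 2i\<close> in each quotient add up to \<open>d\<close>, so the quotient is congruent
  to \<open>q^(4(2i+1))\<close>.\<close>

lemma cq_ratio_top_cong: "ratfun_cong (cq_ratio rat_a rat_q m) rat_q P"
proof -
  let ?G = "\<lambda>i. wp_factor rat_a (rat_q ^ i)"
  have nd: "\<not> d dvd 2 * i + 1" if "i < m" for i
    using that d by (auto dest: dvd_imp_le)
  have nd': "\<not> d dvd 2 * (m - Suc i) + 2" if "i < m" for i
    using that d by (auto dest!: dvd_imp_le)
  have G0: "?G (2 * i + 1) \<noteq> 0" if "i < m" for i
    using local_units_nonzero[OF wp_factor_unit[OF nd[OF that]]] .
  have "cq_ratio rat_a rat_q m = (\<Prod>i<m. ?G (2 * i + 1)) / (\<Prod>i<m. ?G (2 * (m - Suc i) + 2))"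
    unfolding cq_ratio_def prod_dividef prod.nat_diff_reindex[of "\<lambda>i. ?G (2 * i + 2)"] ..
  also have "\<dots> = (\<Prod>i<m. ?G (2 * i + 1) / ?G (2 * (m - Suc i) + 2))"
    by (simp only: prod_dividef)
  also have "ratfun_cong \<dots> (\<Prod>i<m. ?G (2 * i + 1) / (?G (2 * i + 1) / rat_q ^ (4 * (2 * i + 1)))) P" (is "ratfun_cong _ ?t1 _")
    by (intro ratfun_cong_prod ratfun_cong_divide wp_factor_unit local_ring_divide local_units_divide nd nd'
         wp_factor_reflect_cong wp_factor_local) (use d in simp_all)
  also have "?t1 = (\<Prod>i<m. rat_q ^ (4 * (2 * i + 1)))"
    using G0 by (intro prod.cong refl) simp
  also have "\<dots> = rat_q ^ (4 * m^2)"
    by (subst power_sum[symmetric], rule arg_cong[of _ _ "power rat_q"], induction m)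
       (simp_all add: power2_eq_square)
  \<comment> \<open>\<open>4 m^2 = (d - 1)^2\<close>, which leaves remainder 1 modulo
    \<open>d\<close>.\<close>
  also have "4 * m^2 = 1 + d * (d - 2)"
    using d m by (cases m) (simp_all add: power2_eq_square)
  also have "ratfun_cong (rat_q ^ (1 + d * (d - 2))) (rat_q ^ 1) P"
    by (rule rat_q_power_cong)
  finally show ?thesis by simp
qed

text \<open>Removing the last factor on the left mirrors appending the next factor on the right, at
  the cost of \<open>q^4\<close>. The start \<open>k = 0\<close> is
  \<open>cq_ratio_top_cong\<close>.\<close>

lemma cq_ratio_reflect_cong:
  assumes "k \<le> m"
  shows "ratfun_cong (cq_ratio rat_a rat_q (m - k)) (rat_q ^ (4 * k + 1) * cq_ratio rat_a rat_q k) P"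
  using assms
proof (induction k)
  case 0
  show ?case using cq_ratio_top_cong by (simp add: cq_ratio_def)
next
  case (Suc k)
  let ?G = "\<lambda>i. wp_factor rat_a (rat_q ^ i)"
  define j where "j = m - Suc k"
  have j: "m - k = Suc j" "j < m" using Suc.prems by (simp_all add: j_def)
  have k: "k < m" using Suc.prems by simp
  have ndl: "\<not> d dvd i" if "0 < i" "i < d" for i
    using that by (auto dest: dvd_imp_le)
  have units: "?G (2 * j + 1) \<in> local_units P" "?G (2 * j + 2) \<in> local_units P"
    "?G (2 * k + 1) \<in> local_units P" "?G (2 * k + 2) \<in> local_units P"
    by (intro wp_factor_unit ndl; use j k d in simp)+
  note nz = units[THEN local_units_nonzero]
  have "ratfun_cong (?G (2 * j + 2) / ?G (2 * j + 1))
     ((?G (2 * k + 1) / rat_q ^ (4 * (2 * k + 1))) / (?G (2 * k + 2) / rat_q ^ (4 * (2 * k + 2)))) P" (is "ratfun_cong _ ?t2 _")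
    by (intro ratfun_cong_divide wp_factor_reflect_cong units local_units_divide local_units_subset
        rat_q_power_unit) (use j_def k d in simp_all)
  also have "?t2 = ?G (2 * k + 1) / ?G (2 * k + 2) * rat_q ^ 4"
  proof -
    have "4 * (2 * k + 2) = 4 * (2 * k + 1) + 4" by simp
    then show ?thesis by (simp only: power_add) (simp del: power_Suc add: divide_simps)
  qed
  finally have f: "ratfun_cong (?G (2 * j + 2) / ?G (2 * j + 1)) (?G (2 * k + 1) / ?G (2 * k + 2) * rat_q ^ 4) P" .
  have "cq_ratio rat_a rat_q (Suc j) = cq_ratio rat_a rat_q j * (?G (2 * j + 1) / ?G (2 * j + 2))"
    by (simp add: cq_ratio_def)
  then have "cq_ratio rat_a rat_q j = cq_ratio rat_a rat_q (m - k) * (?G (2 * j + 2) / ?G (2 * j + 1))"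
    unfolding j(1) using nz by simp
  also have "ratfun_cong \<dots> (rat_q ^ (4 * k + 1) * cq_ratio rat_a rat_q k * (?G (2 * k + 1) / ?G (2 * k + 2) * rat_q ^ 4)) P" (is "ratfun_cong _ ?t3 _")
    using Suc.IH k
    by (intro ratfun_cong_mult f cq_ratio_local local_ring_mult local_ring_divide units
        local_units_subset[OF units(3)]) simp_all
  also have "?t3 = rat_q ^ (4 * Suc k + 1) * (cq_ratio rat_a rat_q k * (?G (2 * k + 1) / ?G (2 * k + 2)))"
    by (simp add: power_add mult_ac eval_nat_numeral)
  also have "cq_ratio rat_a rat_q k * (?G (2 * k + 1) / ?G (2 * k + 2)) = cq_ratio rat_a rat_q (Suc k)"
    by (simp add: cq_ratio_def)
  finally show ?case unfolding j_def .
qed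

text \<open>The numbers \<open>4(m-k)+1\<close> and \<open>4k+1\<close> add up to \<open>2d\<close>,
  so \<open>[4(m-k)+1] q^(4k+1)\<close> is congruent to \<open>-[4k+1]\<close>; the power of
  \<open>q\<close> is the one supplied by \<open>cq_ratio_reflect_cong\<close>.\<close>

lemma cq_reflect_cong:
  assumes "k \<le> m"
  shows "ratfun_cong (cq rat_a rat_q (m - k)) (- cq rat_a rat_q k) P"
proof -
  have "4 * (m - k) + 1 + (4 * k + 1) = 0 + d * 2"
    using assms d by simp
  then have e: "rat_q ^ (4 * (m - k) + 1) * rat_q ^ (4 * k + 1) = rat_q ^ (0 + d * 2)"
    by (simp only: power_add[symmetric])
  have "qint rat_q (4 * (m - k) + 1) * rat_q ^ (4 * k + 1) = (rat_q ^ (4 * k + 1) - rat_q ^ (0 + d * 2)) / (1 - rat_q)"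
    unfolding qint_eq e[symmetric] by (simp add: algebra_simps)
  also have "ratfun_cong \<dots> ((rat_q ^ (4 * k + 1) - rat_q ^ 0) / (1 - rat_q)) P" (is "ratfun_cong _ ?t4 _")
    by (intro ratfun_cong_divide ratfun_cong_diff rat_q_power_cong ratfun_cong_refl one_minus_q_unit) simp
  also have "?t4 = - qint rat_q (4 * k + 1)"
    unfolding qint_eq by (simp only: power_0 minus_divide_left minus_diff_eq)
  finally have q: "ratfun_cong (qint rat_q (4 * (m - k) + 1) * rat_q ^ (4 * k + 1)) (- qint rat_q (4 * k + 1)) P" .
  have "ratfun_cong (cq rat_a rat_q (m - k))
      (qint rat_q (4 * (m - k) + 1) * (rat_q ^ (4 * k + 1) * cq_ratio rat_a rat_q k)) P" (is "ratfun_cong _ ?t5 _")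
    unfolding cq_eq
    by (intro ratfun_cong_mult ratfun_cong_refl cq_ratio_reflect_cong assms qint_local)
       (simp add: cq_ratio_local del: power_Suc)
  also have "?t5 = qint rat_q (4 * (m - k) + 1) * rat_q ^ (4 * k + 1) * cq_ratio rat_a rat_q k"
    by (simp add: mult_ac)
  also have "ratfun_cong \<dots> (- qint rat_q (4 * k + 1) * cq_ratio rat_a rat_q k) P"
    by (intro ratfun_cong_mult q ratfun_cong_refl cq_ratio_local local_ring_mult qint_local) simp
  finally show ?thesis unfolding cq_eq by simp
qed

text \<open>Reversing the summation gives \<open>T\<close> congruent to \<open>-T\<close>, and 2 is
  invertible over the rationals.\<close>

lemma sum_cq_cong_0: "ratfun_cong (\<Sum>k\<le>m. cq rat_a rat_q k) 0 P"
proof -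
  define T where "T = (\<Sum>k\<le>m. cq rat_a rat_q k)"
  have "T = (\<Sum>k\<le>m. cq rat_a rat_q (m - k))"
    using sum.nat_diff_reindex[of "cq rat_a rat_q" "Suc m"] by (simp add: T_def lessThan_Suc_atMost)
  also have "ratfun_cong \<dots> (\<Sum>k\<le>m. - cq rat_a rat_q k) P" (is "ratfun_cong _ ?t6 _")
    by (intro ratfun_cong_sum cq_reflect_cong) simp
  also have "?t6 = - T" by (simp add: T_def sum_negf)
  finally have "ratfun_cong (T + T) (- T + T) P"
    by (intro ratfun_cong_add ratfun_cong_refl)
  then have "ratfun_cong ((T + T) * to_fract [:[:1 / 2:]:]) 0 P"
    by (intro ratfun_cong_0_mult) simp_all
  moreover have "[:[:1 / 2:]:] + [:[:1 / 2:]:] = (1 :: rat poly poly)"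
    by (simp add: one_pCons)
  then have "to_fract [:[:1 / 2:]:] + to_fract [:[:1 / 2:]:] = (1 :: rat poly poly fract)"
    by (metis to_fract_add to_fract_1)
  then have "(T + T) * to_fract [:[:1 / 2:]:] = T"
    by (metis distrib_left distrib_right mult.right_neutral)
  ultimately show ?thesis
    by (simp only: T_def)
qed

end

section \<open>The convolution sum\<close>

text \<open>Only remainders up to \<open>m\<close> contribute, and two of them add up to less than
  \<open>d\<close>. Without a carry, \<open>i + j < e * d\<close> depends on the quotients alone, so
  the sum factors.\<close>

lemma sum_triangle_digits:
  fixes u v :: "nat \<Rightarrow> 'a::comm_ring_1"
  assumes v: "\<And>k. m < k \<Longrightarrow> k < d \<Longrightarrow> v k = 0" and m: "2 * m < d"
  shows "(\<Sum>(i, j) | i + j < e * d. (u (i div d) * v (i mod d)) * (u (j div d) * v (j mod d))) =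
    (\<Sum>(i, j) | i + j < e. u i * u j) * (\<Sum>k\<le>m. v k)^2"
proof -
  let ?A = "{(i, j). i + j < e * d}" and ?L = "{(i, j). i + j < e}"
  let ?B = "{(i, j). i + j < e * d \<and> i mod d \<le> m \<and> j mod d \<le> m}"
  let ?f = "\<lambda>(i, j). (u (i div d) * v (i mod d)) * (u (j div d) * v (j mod d))"
  let ?join = "\<lambda>((i, j), (k, l)). (i * d + k, j * d + l)"
    and ?split = "\<lambda>(i, j). ((i div d, j div d), (i mod d, j mod d))"
  have d: "d > 0" using m by simp
  have fin: "finite {(i, j). i + j < (s::nat)}" for s
    by (rule finite_subset[of _ "{..<s} \<times> {..<s}"]) auto
  have "sum ?f ?A = sum ?f ?B"
  proof (rule sum.mono_neutral_right)
    have "v (i mod d) = 0" if "\<not> i mod d \<le> m" for i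
      using v d that by simp
    then show "\<forall>p\<in>?A - ?B. ?f p = 0"
      by fastforce
  qed (use fin in auto)
  also have "\<dots> = (\<Sum>((i, j), (k, l))\<in>?L \<times> ({..m} \<times> {..m}). (u i * u j) * (v k * v l))"
  proof (rule sum.reindex_bij_witness[where i = ?join and j = ?split])
    fix p assume p: "p \<in> ?B"
    show "?join (?split p) = p" by (cases p) simp
    obtain i j where ij: "p = (i, j)" by (cases p)
    have "(i div d + j div d) * d \<le> i + j"
      by (metis add_mult_distrib add_mono div_times_less_eq_dividend)
    also have "i + j < e * d"
      using p ij by simp
    finally have "(i div d + j div d) * d < e * d" .
    then show "?split p \<in> ?L \<times> ({..m} \<times> {..m})"
      using p ij by simp
  next
    fix p assume p: "p \<in> ?L \<times> ({..m} \<times> {..m})"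
    obtain i j k l where ij: "p = ((i, j), (k, l))" by (metis prod.collapse)
    have kl: "k < d" "l < d" "k + l < d" using p ij m by auto
    \<comment> \<open>The quotients satisfy \<open>i + j + 1 \<le> e\<close>, which leaves room
      \<open>d\<close> for the sum of the remainders.\<close>
    have "(i + j + 1) * d \<le> e * d" using p ij by (intro mult_right_mono) auto
    then have "i * d + k + (j * d + l) < e * d"
      using kl by (simp add: algebra_simps)
    then show "?join p \<in> ?B"
      using p ij kl by simp
    show "?split (?join p) = p"
      using ij kl by simp
  qed (auto simp: mult_ac)
  also have "\<dots> = (\<Sum>p\<in>?L. (case p of (i, j) \<Rightarrow> u i * u j) * (\<Sum>(k, l)\<in>{..m} \<times> {..m}. v k * v l))"
    by (simp add: sum.cartesian_product' sum_distrib_left case_prod_unfold)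
  also have "(\<Sum>(k, l)\<in>{..m} \<times> {..m}. v k * v l) = (\<Sum>k\<le>m. v k)^2"
    unfolding sum.cartesian_product[symmetric] by (simp add: sum_product power2_eq_square)
  finally show ?thesis by (simp add: sum_distrib_right)
qed

lemma sum_convolution_eq:
  fixes c :: "nat \<Rightarrow> 'a::comm_ring_1"
  assumes "n > 0"
  shows "(\<Sum>k = 0..n - 1. \<Sum>j = 0..k. c j * c (k - j)) = (\<Sum>(i, j) | i + j < n. c i * c j)"
proof -
  have "{0..n - 1} = {..<n}" using assms by auto
  then show ?thesis
    by (simp add: sum.triangle_reindex[of "\<lambda>i j. c i * c j"] atMost_atLeast0)
qed

text \<open>Summing over pairs instead of nested indices allows each index to be divided by
  \<open>d\<close> separately.\<close>

definition cq_conv :: "nat \<Rightarrow> 'a::field \<Rightarrow> 'a \<Rightarrow> 'a" where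
  "cq_conv n a q = (\<Sum>(i, j) | i + j < n. cq a q i * cq a q j)"

text \<open>Each term is replaced by a product \<open>u l * v k\<close> over quotient and remainder;
  then \<open>sum_triangle_digits\<close> exhibits the factor \<open>T^2\<close>, where
  \<open>T\<close> is the sum in \<open>sum_cq_cong_0\<close>.\<close>

lemma cq_conv_cong_cyclotomic:
  assumes d: "d = 2 * m + 1" "m > 0" and n: "n = e * d"
  shows "ratfun_cong (cq_conv n rat_a rat_q) 0 [:cyclotomic d:]"
proof -
  let ?P = "[:cyclotomic d:]" and ?c = "cq rat_a rat_q"
  note [simp] = cq_local[OF d refl] cq_ratio_local[OF d refl]
  \<comment> \<open>The truncation of \<open>v\<close> above \<open>m\<close> turns a vanishing
    congruence into the exact zeros that \<open>sum_triangle_digits\<close> asks for.\<close>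
  define u where "u l = cq_ratio rat_a rat_q (l * d)" for l
  define v where "v k = (if k \<le> m then ?c k else 0)" for k
  have ul: "u l \<in> local_ring ?P" and vl: "v l \<in> local_ring ?P" for l by (simp_all add: u_def v_def)
  have v: "ratfun_cong (?c k) (v k) ?P" if kd: "k < d" for k
  proof (cases "k \<le> m")
    case False
    then obtain z where "z \<in> local_ring ?P" "?c k = to_fract (?P^2) * z"
      using cq_cong_0[OF d refl, of k] kd local_ring_power2[OF d refl] False unfolding ratfun_cong_iff by auto
    then have "ratfun_cong (?c k) 0 ?P"
      by (intro ratfun_congI[of "to_fract ?P * z"])
         (simp_all only: power2_eq_square to_fract_mult mult.assoc diff_0_right local_ring_mult to_fract_in_local_ring)
    then show ?thesis using False by (simp add: v_def)
  qed (simp add: v_def)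
  have uv: "ratfun_cong (?c j) (u (j div d) * v (j mod d)) ?P" for j
  proof -
    have "j mod d < d" using d by simp
    then have "ratfun_cong (?c (j div d * d + j mod d)) (u (j div d) * ?c (j mod d)) ?P"
      unfolding u_def by (rule cq_shift_cong[OF d refl])
    moreover have "ratfun_cong (u (j div d) * ?c (j mod d)) (u (j div d) * v (j mod d)) ?P"
      using v[OF \<open>j mod d < d\<close>] by (intro ratfun_cong_mult ratfun_cong_refl ul vl)
    ultimately show ?thesis
      by (simp add: ratfun_cong_trans)
  qed
  have "ratfun_cong (cq_conv n rat_a rat_q)
     (\<Sum>(i, j) | i + j < n. (u (i div d) * v (i mod d)) * (u (j div d) * v (j mod d))) ?P"
    unfolding cq_conv_def case_prod_unfold
    by (intro ratfun_cong_sum ratfun_cong_mult uv local_ring_mult ul vl) simp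
  moreover have "(\<Sum>k\<le>m. v k) = (\<Sum>k\<le>m. ?c k)"
    by (simp add: v_def)
  then have "(\<Sum>(i, j) | i + j < n. (u (i div d) * v (i mod d)) * (u (j div d) * v (j mod d))) =
      (\<Sum>(i, j) | i + j < e. u i * u j) * (\<Sum>k\<le>m. ?c k)^2"
    unfolding n using d by (subst sum_triangle_digits[of m]) (simp_all add: v_def)
  moreover have "ratfun_cong ((\<Sum>k\<le>m. ?c k) * ((\<Sum>k\<le>m. ?c k) * (\<Sum>(i, j) | i + j < e. u i * u j))) 0 ?P"
    unfolding case_prod_unfold
    by (intro ratfun_cong_0_mult sum_cq_cong_0[OF d refl] local_ring_mult local_ring_sum ul) simp
  then have "ratfun_cong ((\<Sum>(i, j) | i + j < e. u i * u j) * (\<Sum>k\<le>m. ?c k)^2) 0 ?P"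
    by (simp only: power2_eq_square mult_ac)
  ultimately show ?thesis
    by (simp only: ratfun_cong_trans)
qed

text \<open>All indices are below \<open>n\<close>, so no shift is involved and the truncation holds
  modulo \<open>\<Phi>_n^2\<close>. The double sum is then congruent to \<open>T^2\<close> with
  \<open>T\<close> divisible by \<open>\<Phi>_n\<close>.\<close>

lemma cq_conv_cong_cyclotomic_square:
  assumes n: "n = 2 * m + 1" "m > 0"
  shows "ratfun_cong (cq_conv n rat_a rat_q) 0 ([:cyclotomic n:]^2)"
proof -
  let ?P = "[:cyclotomic n:]" and ?c = "cq rat_a rat_q"
  define v where "v k = (if k \<le> m then ?c k else 0)" for k
  note loc = local_ring_power2[OF n refl]
  have vl: "v l \<in> local_ring (?P^2)" and cl: "?c l \<in> local_ring (?P^2)" for l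
    by (simp_all add: v_def loc cq_local[OF n refl])
  have v: "ratfun_cong (?c k) (v k) (?P^2)" if "k < n" for k
    using cq_cong_0[OF n refl, of k] that by (simp add: v_def)
  have "ratfun_cong (cq_conv n rat_a rat_q) (\<Sum>(i, j) | i + j < n. v i * v j) (?P^2)"
    unfolding cq_conv_def case_prod_unfold
    by (intro ratfun_cong_sum ratfun_cong_mult v vl cl) auto
  moreover have "(\<Sum>(i, j) | i + j < n. v i * v j) = (\<Sum>k\<le>m. v k)^2"
  proof -
    have "(\<Sum>(i, j) | i + j < n. v i * v j) = (\<Sum>(i, j) | i + j < 1 * n. (1 * v (i mod n)) * (1 * v (j mod n)))"
      by (intro sum.cong) auto
    also have "\<dots> = (\<Sum>(i, j) | i + j < (1::nat). 1 * 1) * (\<Sum>k\<le>m. v k)^2"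
      by (rule sum_triangle_digits[where m = m and v = v and d = n and e = 1 and u = "\<lambda>_. 1"])
         (use n in \<open>simp_all add: v_def\<close>)
    also have "{(i, j). i + j < (1::nat)} = {(0, 0)}" by auto
    finally show ?thesis by simp
  qed
  moreover have "(\<Sum>k\<le>m. v k) = (\<Sum>k\<le>m. ?c k)"
    by (simp add: v_def)
  ultimately have "ratfun_cong (cq_conv n rat_a rat_q) ((\<Sum>k\<le>m. ?c k)^2) (?P^2)"
    by (simp only:)
  then show ?thesis
    by (rule ratfun_cong_trans[OF _ ratfun_cong_0_power2[OF sum_cq_cong_0[OF n refl]]])
qed

section \<open>The double sum modulo \<open>1 - a q^n\<close> and \<open>a - q^n\<close>\<close>

text \<open>The terms vanish beyond \<open>N\<close> and \<open>n - 1 = 2N\<close>, so the triangle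
  contains every nonzero product and the double sum is a full square.\<close>

lemma cq_conv_terminating:
  fixes q :: "'a::field"
  assumes q: "q \<noteq> 0" "\<And>i. i > 0 \<Longrightarrow> q ^ i \<noteq> 1" and n: "n = 2 * N + 1"
  shows "cq_conv n (q ^ n) q = (qint q n / q ^ N)^2"
proof -
  let ?c = "cq (q ^ n) q"
  have c0: "?c k = 0" if "N < k" for k
    unfolding n using q(1) that by (rule cq_eq_0)
  have "cq_conv n (q ^ n) q = (\<Sum>k\<le>N + N. \<Sum>j\<le>k. ?c j * ?c (k - j))"
  proof -
    have "{(i, j). i + j < n} = {(i, j). i + j \<le> N + N}" using n by auto
    then show ?thesis
      unfolding cq_conv_def by (simp only: sum.triangle_reindex_eq)
  qed
  \<comment> \<open>The product formula for polynomials, evaluated at 1, serves as the Cauchy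
    product.\<close>
  also have "\<dots> = (\<Sum>k\<le>N. ?c k) * (\<Sum>k\<le>N. ?c k)"
    using polynomial_product[of N ?c N ?c 1] c0 by simp
  also have "(\<Sum>k\<le>N. ?c k) = qint q n / q ^ N"
    unfolding n by (rule sum_cq_terminating[OF q])
  finally show ?thesis by (simp add: power2_eq_square)
qed

text \<open>Here \<open>b\<close> stands for \<open>a\<close> or \<open>1/a\<close>. All
  denominators, at \<open>b\<close> and at \<open>q^n\<close>, are units, so \<open>b\<close> can be
  replaced by \<open>q^n\<close> term by term.\<close>

lemma cq_conv_cong_terminating:
  assumes b: "ratfun_cong b (rat_q ^ n) P" and n: "n = 2 * N + 1"
    and q: "rat_q \<in> local_units P" "\<And>i. i > 0 \<Longrightarrow> 1 - rat_q ^ i \<in> local_units P"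
    and u: "b \<in> local_units P" "\<And>i. 1 - b * rat_q ^ (2 * i + 2) \<in> local_units P"
      "\<And>i. 1 - rat_q ^ (2 * i + 2) / b \<in> local_units P"
  shows "ratfun_cong (cq_conv n b rat_q) ((qint rat_q n / rat_q ^ N)^2) P"
proof -
  let ?b = "rat_q ^ n"
  have ql: "rat_q ^ i \<in> local_units P" "rat_q ^ i \<in> local_ring P" for i
    using q(1) by (simp_all add: local_units_power local_units_subset)
  have bl: "b \<in> local_ring P" using u(1) by (rule local_units_subset)
  \<comment> \<open>As \<open>n\<close> is odd, \<open>2i + 2 - n\<close> is a nonzero integer; its
    sign decides the case.\<close>
  have div_unit: "1 - rat_q ^ (2 * i + 2) / ?b \<in> local_units P" for i
  proof (cases "2 * i + 2 < n")
    case True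
    then have "1 - rat_q ^ (2 * i + 2) / ?b = to_fract (- 1) * (1 - rat_q ^ (n - (2 * i + 2))) / rat_q ^ (n - (2 * i + 2))"
      by (simp only: power_diff[OF rat_q_nonzero less_imp_le]) (simp add: field_simps)
    moreover have "to_fract (- 1) \<in> local_units P"
      by (rule to_fract_in_local_units) simp_all
    ultimately show ?thesis
      using True q(2)[of "n - (2 * i + 2)"] ql(1)
      by (simp only: local_units_mult local_units_divide zero_less_diff)
  next
    case False
    then have "2 * i + 2 > n" using n by presburger
    moreover from this have "1 - rat_q ^ (2 * i + 2) / ?b = 1 - rat_q ^ (2 * i + 2 - n)"
      by (simp only: power_diff[OF rat_q_nonzero less_imp_le])
    ultimately show ?thesis
      using q(2)[of "2 * i + 2 - n"] by (simp only: zero_less_diff)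
  qed
  have mult_unit: "1 - ?b * rat_q ^ (2 * i + 2) \<in> local_units P" for i
    using q(2)[of "n + (2 * i + 2)"] by (simp only: power_add)
  have wpu: "wp_factor b (rat_q ^ (2 * i + 2)) \<in> local_units P"
    "wp_factor ?b (rat_q ^ (2 * i + 2)) \<in> local_units P" for i
    unfolding wp_factor_def
    by (intro local_units_mult local_units_power u q(2) div_unit mult_unit; simp)+
  have wpl: "wp_factor b (rat_q ^ i) \<in> local_ring P" for i
    unfolding wp_factor_def using bl ql u(1) by (simp add: local_ring_divide)
  have wpc: "ratfun_cong (wp_factor b (rat_q ^ i)) (wp_factor ?b (rat_q ^ i)) P" for i
    unfolding wp_factor_def
    by (intro ratfun_cong_mult ratfun_cong_diff ratfun_cong_refl ratfun_cong_divide b u ql)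
       (simp_all add: bl ql u local_ring_divide)
  have wl: "cq_ratio b rat_q k \<in> local_ring P" "cq_ratio ?b rat_q k \<in> local_ring P" for k
    unfolding cq_ratio_def using wpl wpc ratfun_cong_local_ring
    by (blast intro: local_ring_prod local_ring_divide wpu)+
  have qi: "qint rat_q k \<in> local_ring P" for k
    unfolding qint_def by (intro local_ring_sum ql)
  have w: "ratfun_cong (cq_ratio b rat_q k) (cq_ratio ?b rat_q k) P" for k
    unfolding cq_ratio_def
    by (intro ratfun_cong_prod ratfun_cong_divide wpc wpl wpu local_ring_divide)
  have c: "ratfun_cong (cq b rat_q k) (cq ?b rat_q k) P" for k
    unfolding cq_eq by (intro ratfun_cong_mult ratfun_cong_refl w qi wl)
  have cl: "cq b rat_q k \<in> local_ring P" "cq ?b rat_q k \<in> local_ring P" for k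
    unfolding cq_eq by (simp_all add: qi wl)
  have "ratfun_cong (cq_conv n b rat_q) (cq_conv n ?b rat_q) P"
    unfolding cq_conv_def case_prod_unfold by (intro ratfun_cong_sum ratfun_cong_mult c cl)
  then show ?thesis
    using cq_conv_terminating[OF rat_q_nonzero rat_q_power_neq_1 n] by simp
qed

text \<open>The combination eliminates \<open>a\<close>: a common divisor divides the constant
  \<open>c\<close>, which is coprime to \<open>B\<close> because of the coefficient 1.\<close>

lemma coprime_if_const_combination:
  fixes A B :: "rat poly poly"
  assumes "x * A + y * B = [:c:]" "c \<noteq> 0" "coeff B i = 1"
  shows "coprime A B"
proof (rule coprimeI)
  fix D assume D: "D dvd A" "D dvd B"
  then have "D dvd [:c:]"
    using assms(1) by (metis dvd_add dvd_mult)
  then show "is_unit D"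
    using coprime_const_poly[OF assms(3,2)] D(2) coprime_common_divisor by blast
qed

lemma pol_q_power_diff:
  assumes "i \<noteq> j"
  obtains c where "pol_q ^ i - pol_q ^ j = [:c:]" "c \<noteq> 0"
  using that[of "monom 1 i - monom 1 j"] assms monom_eq_iff'[of "1::rat" i 1 j]
  by (simp add: pol_q_power)

text \<open>In each case a combination free of \<open>a\<close> is a nonzero polynomial in
  \<open>q\<close>, namely 1, \<open>q^n - q^j\<close> or \<open>1 - q^(n+j)\<close>. This covers
  the denominators of \<open>cq\<close> and the other factors of the modulus.\<close>

lemma coprime_one_minus:
  assumes n: "n > 0"
  defines "L \<equiv> 1 - pol_a * pol_q ^ n"
  shows "coprime pol_a L" "j \<noteq> n \<Longrightarrow> coprime (1 - pol_a * pol_q ^ j) L" "coprime (pol_a - pol_q ^ j) L"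
    "p \<noteq> 0 \<Longrightarrow> coprime [:p:] L"
proof -
  have co: "coeff L 0 = 1" by (simp add: L_def pol_a_def one_pCons)
  show "coprime pol_a L"
    by (rule coprime_if_const_combination[of "pol_q ^ n" _ 1 _ 1 0])
       (use co in \<open>simp_all add: L_def one_pCons[symmetric] mult_ac\<close>)
  show "coprime (1 - pol_a * pol_q ^ j) L" if ne: "j \<noteq> n"
  proof -
    obtain c where "pol_q ^ n - pol_q ^ j = [:c:]" "c \<noteq> 0" using ne by (metis pol_q_power_diff)
    then show ?thesis
      by (intro coprime_if_const_combination[of "pol_q ^ n" _ "- (pol_q ^ j)" _ c 0])
         (use co in \<open>simp_all add: L_def algebra_simps\<close>)
  qed
  show "coprime (pol_a - pol_q ^ j) L"
  proof -
    obtain c where "pol_q ^ 0 - pol_q ^ (n + j) = [:c:]" "c \<noteq> 0"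
      using n by (metis pol_q_power_diff add_is_0 not_gr0)
    then show ?thesis
      by (intro coprime_if_const_combination[of "pol_q ^ n" _ 1 _ c 0])
         (use co in \<open>simp_all add: L_def algebra_simps power_add\<close>)
  qed
  show "coprime [:p:] L" if "p \<noteq> 0"
    using coprime_const_poly[OF co that] by (simp add: coprime_commute)
qed

lemma coprime_minus_power:
  assumes n: "n > 0"
  defines "L \<equiv> pol_a - pol_q ^ n"
  shows "coprime pol_a L" "coprime (1 - pol_a * pol_q ^ j) L" "j \<noteq> n \<Longrightarrow> coprime (pol_a - pol_q ^ j) L"
    "p \<noteq> 0 \<Longrightarrow> coprime [:p:] L"
proof -
  have co: "coeff L 1 = 1" by (simp add: L_def pol_a_def pol_q_power)
  show "coprime pol_a L"
    by (rule coprime_if_const_combination[of 1 _ "- 1" _ "monom 1 n" 1])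
       (use co in \<open>simp_all add: L_def pol_q_power\<close>)
  show "coprime (1 - pol_a * pol_q ^ j) L"
  proof -
    obtain c where "pol_q ^ 0 - pol_q ^ (n + j) = [:c:]" "c \<noteq> 0"
      using n by (metis pol_q_power_diff add_is_0 not_gr0)
    then show ?thesis
      by (intro coprime_if_const_combination[of 1 _ "pol_q ^ j" _ c 1])
         (use co in \<open>simp_all add: L_def algebra_simps power_add\<close>)
  qed
  show "coprime (pol_a - pol_q ^ j) L" if ne: "j \<noteq> n"
  proof -
    obtain c where "pol_q ^ n - pol_q ^ j = [:c:]" "c \<noteq> 0" using ne by (metis pol_q_power_diff)
    then show ?thesis
      by (intro coprime_if_const_combination[of 1 _ "- 1" _ c 1])
         (use co in \<open>simp_all add: L_def algebra_simps\<close>)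
  qed
  show "coprime [:p:] L" if "p \<noteq> 0"
    using coprime_const_poly[OF co that] by (simp add: coprime_commute)
qed

lemma rat_q_units:
  assumes "\<And>p. p \<noteq> 0 \<Longrightarrow> coprime [:p:] P"
  shows "rat_q \<in> local_units P" "i > 0 \<Longrightarrow> 1 - rat_q ^ i \<in> local_units P"
proof -
  show "rat_q \<in> local_units P"
    unfolding rat_q_def by (intro to_fract_in_local_units) (simp_all add: pol_q_def assms)
  show "1 - rat_q ^ i \<in> local_units P" if pos: "i > 0"
  proof -
    obtain c where c: "pol_q ^ 0 - pol_q ^ i = [:c:]" "c \<noteq> 0"
      using pos by (metis pol_q_power_diff not_gr0)
    then have "to_fract (pol_q ^ 0 - pol_q ^ i) \<in> local_units P"
      by (intro to_fract_in_local_units) (simp_all add: assms)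
    then show ?thesis by (simp add: rat_q_power)
  qed
qed

lemma cq_conv_cong_one_minus:
  assumes n: "n = 2 * N + 1"
  shows "ratfun_cong (cq_conv n rat_a rat_q) ((qint rat_q n / rat_q ^ N)^2) (1 - pol_a * pol_q ^ n)"
    (is "ratfun_cong _ _ ?P")
proof -
  have n0: "n > 0" using n by simp
  note co = coprime_one_minus[OF n0]
  have nz: "1 - pol_a * pol_q ^ j \<noteq> 0" "pol_a - pol_q ^ j \<noteq> 0" "pol_a \<noteq> 0" for j
    by (simp_all add: pol_a_def pol_q_power one_pCons)
  have au: "rat_a \<in> local_units ?P"
    unfolding rat_a_def using nz co by (intro to_fract_in_local_units)
  \<comment> \<open>The witness comes from \<open>1/a - q^n = (1 - a q^n) / a\<close>.\<close>
  have b: "ratfun_cong (1 / rat_a) (rat_q ^ n) ?P"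
    by (rule ratfun_congI[of "1 / rat_a"])
       (simp_all add: local_ring_divide au field_simps rat_q_power flip: rat_a_def)
  have u2: "1 - 1 / rat_a * rat_q ^ (2 * i + 2) \<in> local_units ?P" for i
  proof -
    have "to_fract (pol_a - pol_q ^ (2 * i + 2)) \<in> local_units ?P"
      using nz co by (intro to_fract_in_local_units)
    then have "(rat_a - rat_q ^ (2 * i + 2)) / rat_a \<in> local_units ?P"
      unfolding to_fract_diff rat_a_def[symmetric] rat_q_power[symmetric] using au by (rule local_units_divide)
    also have "(rat_a - rat_q ^ (2 * i + 2)) / rat_a = 1 - 1 / rat_a * rat_q ^ (2 * i + 2)"
      by (simp only: diff_divide_distrib) simp
    finally show ?thesis .
  qed
  have u3: "1 - rat_q ^ (2 * i + 2) / (1 / rat_a) \<in> local_units ?P" for i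
  proof -
    have "2 * i + 2 \<noteq> n" using n by presburger
    then have "to_fract (1 - pol_a * pol_q ^ (2 * i + 2)) \<in> local_units ?P"
      using nz co by (intro to_fract_in_local_units)
    then show ?thesis
      unfolding to_fract_diff to_fract_mult to_fract_1 rat_a_def[symmetric] rat_q_power[symmetric]
      by (simp add: mult.commute del: power_Suc add_2_eq_Suc')
  qed
  have "cq_conv n (1 / rat_a) rat_q = cq_conv n rat_a rat_q"
    by (simp only: cq_conv_def cq_inverse)
  then show ?thesis
    using cq_conv_cong_terminating[OF b n rat_q_units[OF co(4)] local_units_divide[OF local_units_1 au] u2 u3]
    by simp
qed

lemma cq_conv_cong_minus_power:
  assumes n: "n = 2 * N + 1"
  shows "ratfun_cong (cq_conv n rat_a rat_q) ((qint rat_q n / rat_q ^ N)^2) (pol_a - pol_q ^ n)"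
    (is "ratfun_cong _ _ ?P")
proof -
  have n0: "n > 0" using n by simp
  note co = coprime_minus_power[OF n0]
  have nz: "1 - pol_a * pol_q ^ j \<noteq> 0" "pol_a - pol_q ^ j \<noteq> 0" "pol_a \<noteq> 0" for j
    by (simp_all add: pol_a_def pol_q_power one_pCons)
  have au: "rat_a \<in> local_units ?P"
    unfolding rat_a_def using nz co by (intro to_fract_in_local_units)
  have b: "ratfun_cong rat_a (rat_q ^ n) ?P"
    by (rule ratfun_congI[of 1]) (simp_all add: rat_q_power rat_a_def)
  have u2: "1 - rat_a * rat_q ^ (2 * i + 2) \<in> local_units ?P" for i
  proof -
    have "to_fract (1 - pol_a * pol_q ^ (2 * i + 2)) \<in> local_units ?P"
      using nz co by (intro to_fract_in_local_units)
    then show ?thesis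
      unfolding to_fract_diff to_fract_mult to_fract_1 rat_a_def[symmetric] rat_q_power[symmetric] .
  qed
  have u3: "1 - rat_q ^ (2 * i + 2) / rat_a \<in> local_units ?P" for i
  proof -
    have "2 * i + 2 \<noteq> n" using n by presburger
    then have "to_fract (pol_a - pol_q ^ (2 * i + 2)) \<in> local_units ?P"
      using nz co by (intro to_fract_in_local_units)
    then have "(rat_a - rat_q ^ (2 * i + 2)) / rat_a \<in> local_units ?P"
      unfolding to_fract_diff rat_a_def[symmetric] rat_q_power[symmetric] using au by (rule local_units_divide)
    also have "(rat_a - rat_q ^ (2 * i + 2)) / rat_a = 1 - rat_q ^ (2 * i + 2) / rat_a"
      by (simp only: diff_divide_distrib) simp
    finally show ?thesis .
  qed
  show ?thesis
    by (rule cq_conv_cong_terminating[OF b n rat_q_units[OF co(4)] au u2 u3])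
qed

section \<open>Combination of the coprime moduli\<close>

theorem theorem4p3:
  fixes n :: nat
  assumes "n > 0" and "odd n"
  shows "ratfun_cong
           (\<Sum>k = 0..n - 1. \<Sum>j = 0..k. cq rat_a rat_q j * cq rat_a rat_q (k - j))
           (rat_q powi (1 - int n) * (qint rat_q n)^2)
           (qint pol_q n * [:cyclotomic n:] * (1 - pol_a * pol_q ^ n) * (pol_a - pol_q ^ n))"
proof (cases "n = 1")
  \<comment> \<open>For \<open>n = 1\<close> both sides are equal to 1; the results modulo
    \<open>\<Phi>_d\<close> assume \<open>d > 1\<close>.\<close>
  case True
  then show ?thesis by (simp add: qint_def)
next
  case False
  then obtain N where n: "n = 2 * N + 1" "N > 0"
    using assms(2) by (metis oddE add_0 mult_0_right not_gr0)
  let ?S = "cq_conv n rat_a rat_q" and ?R = "(qint rat_q n / rat_q ^ N)^2"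
  let ?\<Phi> = "\<lambda>d. [:cyclotomic d:]"
  let ?L1 = "1 - pol_a * pol_q ^ n" and ?L2 = "pol_a - pol_q ^ n"
  let ?D = "{d. d dvd n \<and> d \<noteq> 1}"
  have fin: "finite ?D" using assms(1) by simp
  have pos: "d > 0" if "d \<in> ?D" for d
    using that assms(1) by (auto intro: Nat.gr0I)
  have qint_pol: "qint pol_q n = (\<Prod>d\<in>?D. ?\<Phi> d)"
    unfolding qint_pol_q qint_eq_prod_cyclotomic[OF assms(1)] prod_const_poly ..
  have qint_rat: "qint rat_q n = to_fract (qint pol_q n)"
    by (simp add: qint_def rat_q_power)
  have qint_cong: "ratfun_cong (qint rat_q n) 0 (?\<Phi> d)" if "d \<in> ?D" for d
    unfolding qint_rat qint_pol using fin that by (intro ratfun_cong_0_if_dvd dvd_prodI)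
  \<comment> \<open>Since \<open>\<Phi>_n\<close> already divides \<open>[n]\<close>, it occurs
    squared in the modulus; hence \<open>n\<close> is separated from the other divisors.\<close>
  have nD: "n \<in> ?D" using False by simp
  \<comment> \<open>Both sides are congruent to 0, the right one because \<open>[n]\<close> is
    divisible by \<open>\<Phi>_d\<close>.\<close>
  have cong_d: "ratfun_cong ?S ?R (?\<Phi> d)" if dD: "d \<in> ?D - {n}" for d
  proof -
    have "odd d" using that assms(2) by (auto dest: dvd_trans)
    then obtain m where m: "d = 2 * m + 1" by (auto elim: oddE)
    then have "m > 0" using that by (cases m) auto
    moreover obtain e where "n = e * d" using dD by (auto elim!: dvdE simp: mult.commute)
    ultimately have "ratfun_cong ?S 0 (?\<Phi> d)"
      using m by (intro cq_conv_cong_cyclotomic)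
    moreover have "qint rat_q n * (qint rat_q n / (rat_q ^ N)^2) = ?R"
      by (simp add: power_divide power2_eq_square)
    moreover have "ratfun_cong (qint rat_q n * (qint rat_q n / (rat_q ^ N)^2)) 0 (?\<Phi> d)"
      using dD pos
      by (intro ratfun_cong_0_mult qint_cong local_ring_divide local_units_power rat_q_unit_cyclotomic)
         (simp_all add: qint_rat)
    ultimately show ?thesis
      by (metis ratfun_cong_trans ratfun_cong_sym)
  qed
  have cong_n: "ratfun_cong ?S ?R (?\<Phi> n ^ 2)"
  proof -
    have "ratfun_cong ((qint rat_q n)^2 * (1 / (rat_q ^ N)^2)) 0 (?\<Phi> n ^ 2)"
      unfolding local_ring_power2[OF n refl]
      by (intro ratfun_cong_0_mult ratfun_cong_0_power2 qint_cong nD)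
         (simp add: local_ring_power2[OF n refl] local_ring_divide local_units_power rat_q_unit_cyclotomic assms(1))
    then have "ratfun_cong ?R 0 (?\<Phi> n ^ 2)"
      by (simp add: power_divide)
    then show ?thesis
      using cq_conv_cong_cyclotomic_square[OF n] ratfun_cong_trans ratfun_cong_sym by blast
  qed
  note co1 = coprime_one_minus[OF assms(1)] and co2 = coprime_minus_power[OF assms(1)]
  have \<Phi>0: "cyclotomic d \<noteq> 0" if "d > 0" for d
    using that by (rule cyclotomic_nonzero)
  have cong_L: "ratfun_cong ?S ?R (?L1 * ?L2)"
    by (intro ratfun_cong_coprime_mult cq_conv_cong_one_minus cq_conv_cong_minus_power n(1) co2)
  have "ratfun_cong ?S ?R (?\<Phi> n ^ 2 * (?L1 * ?L2))"
    using \<Phi>0[OF assms(1)] by (intro ratfun_cong_coprime_mult[OF cong_n cong_L]) (simp add: co1 co2)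
  then have "ratfun_cong ?S ?R ((\<Prod>d\<in>?D - {n}. ?\<Phi> d) * (?\<Phi> n ^ 2 * (?L1 * ?L2)))"
  proof (intro ratfun_cong_prod_coprime cong_d)
    show "coprime (?\<Phi> i) (?\<Phi> j)" if "i \<in> ?D - {n}" "j \<in> ?D - {n}" "i \<noteq> j" for i j
      using that pos by (intro coprime_const_const_poly coprime_cyclotomic) auto
    show "coprime (?\<Phi> i) (?\<Phi> n ^ 2 * (?L1 * ?L2))" if "i \<in> ?D - {n}" for i
      using that pos[of i] \<Phi>0[of i] assms(1)
      by (simp add: co1 co2 coprime_const_const_poly coprime_cyclotomic)
  qed (use fin in auto)
  also have "(\<Prod>d\<in>?D - {n}. ?\<Phi> d) * (?\<Phi> n ^ 2 * (?L1 * ?L2)) = qint pol_q n * ?\<Phi> n * ?L1 * ?L2"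
    unfolding qint_pol prod.remove[OF fin nD] by (simp only: power2_eq_square mult_ac)
  also have "?S = (\<Sum>k = 0..n - 1. \<Sum>j = 0..k. cq rat_a rat_q j * cq rat_a rat_q (k - j))"
    unfolding cq_conv_def sum_convolution_eq[OF assms(1)] ..
  also have "?R = rat_q powi (1 - int n) * (qint rat_q n)^2"
  proof -
    \<comment> \<open>This matches \<open>q^(1-n)\<close> with the square of \<open>1 / q^N\<close>
      from the terminating sum.\<close>
    have "1 - int n = - int (2 * N)" using n by simp
    then show ?thesis
      by (simp only: power_int_minus power_int_of_nat)
         (simp add: power_divide field_simps flip: power_mult)
  qed
  finally show ?thesis .
qed

end
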